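(* For every finite simple graph $G$, $\chi(G)\le \frac{4}{5}\,\omega(D(G))+\frac{1}{5}\Delta(G)+1$.
   Context: All graphs are finite and simple. $D(G)$ is the degree sequence of $G$; for a degree sequence $D$, $\omega(D)$ is the maximum clique number $\omega(H)$ over all simple graphs $H$ whose degree sequence is $D$. $\chi(G)$ is the chromatic number and $\Delta(G)$ the maximum degree of $G$. *)

theory Defs
  imports Complex_Main "HOL-Library.Multiset" "HOL-Library.Ramsey"
begin

definition simple_graph :: "'a set \<Rightarrow> 'a set set \<Rightarrow> bool" where
  "simple_graph V E \<longleftrightarrow> finite V \<and> E \<subseteq> [V]\<^bsup>2\<^esup>"

definition degree :: "'a set set \<Rightarrow> 'a \<Rightarrow> nat" where
  "degree E v = card {e \<in> E. v \<in> e}"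

definition max_degree :: "'a set \<Rightarrow> 'a set set \<Rightarrow> nat" where
  \<comment> \<open>\<open>insert 0\<close> only matters for \<open>V = {}\<close>, where \<open>Max\<close> of the empty set is unspecified\<close>
  "max_degree V E = Max (insert 0 (degree E ` V))"

definition degree_sequence :: "'a set \<Rightarrow> 'a set set \<Rightarrow> nat list" where
  \<comment> \<open>listed in nonincreasing order, so that it does not depend on an enumeration of \<open>V\<close>\<close>
  "degree_sequence V E = rev (sorted_list_of_multiset (image_mset (degree E) (mset_set V)))"

definition clique_number :: "'a set \<Rightarrow> 'a set set \<Rightarrow> nat" where
  "clique_number V E = Max {card K |K. K \<subseteq> V \<and> clique K E}"

definition proper_coloring :: "'a set \<Rightarrow> 'a set set \<Rightarrow> nat \<Rightarrow> ('a \<Rightarrow> nat) \<Rightarrow> bool" where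
  "proper_coloring V E k c \<longleftrightarrow>
     c ` V \<subseteq> {..<k} \<and> (\<forall>u\<in>V. \<forall>v\<in>V. {u, v} \<in> E \<longrightarrow> c u \<noteq> c v)"

definition chromatic_number :: "'a set \<Rightarrow> 'a set set \<Rightarrow> nat" where
  "chromatic_number V E = (LEAST k. \<exists>c. proper_coloring V E k c)"

definition degree_seq_clique_number :: "nat list \<Rightarrow> nat" where
  \<comment> \<open>the realizations range over graphs on finite sets of natural numbers; the lemmas
      \<open>clique_number_le_degree_seq_clique_number\<close> and \<open>degree_seq_clique_number_attained\<close>
      below show that this is the maximum over realizations on any vertex type\<close>
  "degree_seq_clique_number D =
     Max {clique_number V E |(V :: nat set) E. simple_graph V E \<and> degree_sequence V E = D}"

lemma length_degree_sequence: "length (degree_sequence V E) = card V"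
  by (metis degree_sequence_def length_rev mset_sorted_list_of_multiset size_image_mset
      size_mset size_mset_set)

lemma clique_number_le_card:
  assumes "simple_graph V E"
  shows "clique_number V E \<le> card V"
proof -
  have fin: "finite V" using assms by (simp add: simple_graph_def)
  have "finite {card K |K. K \<subseteq> V \<and> clique K E}"
    using fin by simp
  moreover have "{card K |K. K \<subseteq> V \<and> clique K E} \<noteq> {}"
    using null_clique by blast
  ultimately show ?thesis
    unfolding clique_number_def using fin by (subst Max_le_iff) (auto intro: card_mono)
qed

lemma finite_realization_clique_numbers:
  "finite {clique_number V E |(V :: nat set) E. simple_graph V E \<and> degree_sequence V E = D}"
proof (rule finite_subset)
  show "{clique_number V E |(V :: nat set) E. simple_graph V E \<and> degree_sequence V E = D}
          \<subseteq> {..length D}"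
    by (auto simp: length_degree_sequence intro: clique_number_le_card)
qed simp

lemma simple_graph_nat_copy:
  fixes V :: "'a set"
  assumes G: "simple_graph V E"
  obtains W :: "nat set" and F where "simple_graph W F"
    "degree_sequence W F = degree_sequence V E" "clique_number W F = clique_number V E"
proof -
  have fin: "finite V" and E: "\<And>e. e \<in> E \<Longrightarrow> e \<subseteq> V \<and> finite e \<and> card e = 2"
    using G unfolding simple_graph_def nsets_def by blast+
  obtain f :: "'a \<Rightarrow> nat" where f: "inj_on f V"
    using finite_imp_inj_to_nat_seg[OF fin] by metis
  define W where "W = f ` V"
  define F where "F = (`) f ` E"
  have injE: "inj_on ((`) f) (Pow V)"
    using f by (rule inj_on_image_Pow)
  have sg: "simple_graph W F"
    unfolding simple_graph_def W_def F_def nsets_def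
    using fin E f by (auto simp: card_image inj_on_subset)
  have deg: "degree F (f v) = degree E v" if "v \<in> V" for v
  proof -
    have "{e \<in> F. f v \<in> e} = (`) f ` {e \<in> E. v \<in> e}"
      unfolding F_def using f E that by (auto dest: inj_onD)
    moreover have "inj_on ((`) f) {e \<in> E. v \<in> e}"
      by (rule inj_on_subset[OF injE]) (use E in auto)
    ultimately show ?thesis
      by (simp add: degree_def card_image)
  qed
  have "image_mset (degree F) (mset_set W) = image_mset (degree F) (image_mset f (mset_set V))"
    unfolding W_def using f by (simp add: image_mset_mset_set)
  also have "\<dots> = image_mset (degree E) (mset_set V)"
    using deg fin by (auto simp: multiset.map_comp intro!: image_mset_cong)
  finally have ds: "degree_sequence W F = degree_sequence V E"
    by (simp add: degree_sequence_def)
  have edge: "{f u, f v} \<in> F \<longleftrightarrow> {u, v} \<in> E" if "u \<in> V" "v \<in> V" for u v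
  proof
    assume "{f u, f v} \<in> F"
    then obtain e where e: "e \<in> E" "f ` e = f ` {u, v}" by (auto simp: F_def)
    then have "e = {u, v}"
      using injE E that by (metis (no_types, lifting) PowI empty_subsetI inj_onD insert_subset)
    with e show "{u, v} \<in> E" by simp
  next
    assume "{u, v} \<in> E"
    then have "f ` {u, v} \<in> F" unfolding F_def by (rule imageI)
    then show "{f u, f v} \<in> F" by simp
  qed
  have cl: "clique (f ` K) F \<longleftrightarrow> clique K E" if "K \<subseteq> V" for K
  proof -
    have "f u \<noteq> f v \<longleftrightarrow> u \<noteq> v" "{f u, f v} \<in> F \<longleftrightarrow> {u, v} \<in> E" if "u \<in> K" "v \<in> K" for u v
      using f edge that \<open>K \<subseteq> V\<close> by (auto dest: inj_onD)
    then show ?thesis by (simp add: clique_def)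
  qed
  have "{card K |K. K \<subseteq> W \<and> clique K F} = {card K |K. K \<subseteq> V \<and> clique K E}"
  proof (intro equalityI subsetI)
    fix n assume "n \<in> {card K |K. K \<subseteq> W \<and> clique K F}"
    then obtain L where L: "n = card L" "L \<subseteq> f ` V" "clique L F" by (auto simp: W_def)
    then obtain K where "K \<subseteq> V" "L = f ` K" by (meson subset_imageE)
    with L show "n \<in> {card K |K. K \<subseteq> V \<and> clique K E}"
      using cl f by (auto simp: card_image inj_on_subset)
  next
    fix n assume "n \<in> {card K |K. K \<subseteq> V \<and> clique K E}"
    then obtain K where K: "n = card K" "K \<subseteq> V" "clique K E" by auto
    then have "n = card (f ` K)" "f ` K \<subseteq> W" "clique (f ` K) F"
      using cl f by (auto simp: card_image inj_on_subset W_def)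
    then show "n \<in> {card K |K. K \<subseteq> W \<and> clique K F}" by blast
  qed
  then have "clique_number W F = clique_number V E"
    by (simp add: clique_number_def)
  with sg ds show thesis by (rule that)
qed

lemma clique_number_le_degree_seq_clique_number:
  fixes V :: "'a set"
  assumes "simple_graph V E"
  shows "clique_number V E \<le> degree_seq_clique_number (degree_sequence V E)"
proof -
  obtain W :: "nat set" and F where "simple_graph W F"
    "degree_sequence W F = degree_sequence V E" "clique_number W F = clique_number V E"
    using simple_graph_nat_copy[OF assms] .
  then show ?thesis
    unfolding degree_seq_clique_number_def
    by (intro Max_ge[OF finite_realization_clique_numbers]) (smt (verit) mem_Collect_eq)
qed

lemma degree_seq_clique_number_attained:
  fixes V :: "'a set"
  assumes "simple_graph V E"
  obtains W :: "nat set" and F where "simple_graph W F"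
    "degree_sequence W F = degree_sequence V E"
    "clique_number W F = degree_seq_clique_number (degree_sequence V E)"
proof -
  let ?S = "{clique_number W F |(W :: nat set) F.
               simple_graph W F \<and> degree_sequence W F = degree_sequence V E}"
  have "?S \<noteq> {}"
    using simple_graph_nat_copy[OF assms] by (smt (verit) empty_Collect_eq)
  then have "Max ?S \<in> ?S"
    by (intro Max_in finite_realization_clique_numbers)
  then show thesis
    using that unfolding degree_seq_clique_number_def by (smt (verit) mem_Collect_eq)
qed

end

theory Submission
  imports Defs
begin

text \<open>
  Let \<open>k\<close> be the chromatic number and \<open>S\<close> a minimal vertex set that cannot be coloured with fewer
  than \<open>k\<close> colours; write \<open>m\<close> for its size. Gallai's argument applied to an optimal colouring of \<open>S\<close>
  with as few singleton classes as possible shows that every co-component (component of the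
  complement) contains at most one singleton class, and that a co-component with a singleton class
  is either a single vertex, which is then adjacent to all of \<open>S\<close>, or meets at least three classes.
  Counting gives \<open>2k - m \<le> a + r\<close> and \<open>a + 3r \<le> k\<close>, where \<open>a\<close> and \<open>r\<close> are the numbers of
  co-components of these two kinds, together with a lower bound for the degree of a singleton class.

  On the other hand, a graph with at least \<open>2s\<close> vertices and minimum degree at least \<open>s - 1\<close> has a
  realization of its degree sequence with a clique of size \<open>s\<close>. Applied to \<open>S\<close> without its \<open>a\<close>
  universal vertices, this shows that \<open>k\<close> or \<open>a + \<lfloor>(m - a) / 2\<rfloor>\<close>, whichever is smaller, is at most
  the clique number of the degree sequence, and the theorem follows by arithmetic.
\<close>

subsection \<open>Degrees and switchings\<close>

definition nbrs :: "'a set set \<Rightarrow> 'a \<Rightarrow> 'a set" where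
  "nbrs E v = {w. {v, w} \<in> E}"

lemma nsets2_iff: "{x, y} \<in> [V]\<^bsup>2\<^esup> \<longleftrightarrow> x \<in> V \<and> y \<in> V \<and> x \<noteq> y"
  by (auto simp: nsets_def card_2_iff doubleton_eq_iff)

lemma nsets2_cases:
  assumes "e \<in> [V]\<^bsup>2\<^esup>"
  obtains x y where "e = {x, y}" "x \<in> V" "y \<in> V" "x \<noteq> y"
  using assms by (auto simp: nsets_def card_2_iff)

lemma edgesD:
  assumes "E \<subseteq> [V]\<^bsup>2\<^esup>" "{x, y} \<in> E"
  shows "x \<in> V" "y \<in> V" "x \<noteq> y"
  using subsetD[OF assms] by (simp_all add: nsets2_iff)

lemma finite_edges: "finite V \<Longrightarrow> E \<subseteq> [V]\<^bsup>2\<^esup> \<Longrightarrow> finite E"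
  using finite_subset[of E "[V]\<^bsup>2\<^esup>"] finite_imp_finite_nsets[of V 2] by simp

lemma nbrs_subset: "E \<subseteq> [V]\<^bsup>2\<^esup> \<Longrightarrow> nbrs E v \<subseteq> V - {v}"
  using edgesD[of E V v] by (auto simp: nbrs_def)

lemma finite_nbrs: "finite V \<Longrightarrow> E \<subseteq> [V]\<^bsup>2\<^esup> \<Longrightarrow> finite (nbrs E v)"
  using finite_subset[OF nbrs_subset[of E V v]] by simp

lemma nbrs_sym: "w \<in> nbrs E v \<longleftrightarrow> v \<in> nbrs E w"
  by (simp add: nbrs_def insert_commute)

lemma degree_eq_card_nbrs:
  assumes "E \<subseteq> [V]\<^bsup>2\<^esup>"
  shows "degree E v = card (nbrs E v)"
proof -
  have "bij_betw (\<lambda>w. {v, w}) (nbrs E v) {e \<in> E. v \<in> e}"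
  proof (rule bij_betwI')
    fix e assume "e \<in> {e \<in> E. v \<in> e}"
    then have "e \<in> E" "v \<in> e" by auto
    moreover obtain x y where "e = {x, y}"
      using \<open>e \<in> E\<close> assms nsets2_cases by blast
    ultimately have "e = {v, x} \<or> e = {v, y}" by auto
    then show "\<exists>w\<in>nbrs E v. e = {v, w}"
      using \<open>e \<in> E\<close> unfolding nbrs_def by auto
  qed (auto simp: nbrs_def doubleton_eq_iff)
  then show ?thesis
    unfolding degree_def by (metis bij_betw_same_card)
qed

lemma degree_insert:
  "finite E \<Longrightarrow> e \<notin> E \<Longrightarrow> degree (insert e E) v = degree E v + of_bool (v \<in> e)"
proof -
  assume "finite E" "e \<notin> E"
  moreover have "{x \<in> insert e E. v \<in> x} = (if v \<in> e then insert e {x \<in> E. v \<in> x} else {x \<in> E. v \<in> x})"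
    by auto
  ultimately show ?thesis by (simp add: degree_def)
qed

lemma degree_remove:
  assumes "finite E" "e \<in> E"
  shows "degree E v = degree (E - {e}) v + of_bool (v \<in> e)"
  using degree_insert[of "E - {e}" e v] assms by (simp add: insert_absorb)

lemma degree_Un_disjoint:
  assumes "finite E" "finite F" "E \<inter> F = {}"
  shows "degree (E \<union> F) v = degree E v + degree F v"
proof -
  have "{e \<in> E \<union> F. v \<in> e} = {e \<in> E. v \<in> e} \<union> {e \<in> F. v \<in> e}" by auto
  then show ?thesis
    unfolding degree_def using assms by (simp add: card_Un_disjoint disjoint_iff)
qed

lemma degree_mono: "finite F \<Longrightarrow> E \<subseteq> F \<Longrightarrow> degree E v \<le> degree F v"
  unfolding degree_def by (rule card_mono) auto

lemma sum_degree_eq: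
  assumes "finite E" "finite U"
  shows "(\<Sum>v\<in>U. degree E v) = (\<Sum>e\<in>E. card (e \<inter> U))"
proof -
  have "(\<Sum>v\<in>U. degree E v) = (\<Sum>v\<in>U. \<Sum>e\<in>E. of_bool (v \<in> e))"
    using assms by (simp add: degree_def sum.If_cases of_bool_def Int_def)
  also have "\<dots> = (\<Sum>e\<in>E. \<Sum>v\<in>U. of_bool (v \<in> e))"
    by (rule sum.swap)
  also have "\<dots> = (\<Sum>e\<in>E. card (e \<inter> U))"
    using assms by (simp add: of_bool_def sum.If_cases Int_def conj_commute)
  finally show ?thesis .
qed

lemma handshake:
  assumes "finite V" "E \<subseteq> [V]\<^bsup>2\<^esup>"
  shows "(\<Sum>v\<in>V. degree E v) = 2 * card E"
proof -
  have "card (e \<inter> V) = 2" if "e \<in> E" for e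
    using that assms by (auto simp: nsets_def Int_absorb2)
  then show ?thesis
    using assms finite_edges[OF assms] by (simp add: sum_degree_eq)
qed

text \<open>Each degree splits into common neighbours, the possible edge between \<open>x\<close>
  and \<open>y\<close>, and private neighbours; the first two parts are symmetric. Hence a vertex of
  larger degree has a private neighbour, the source of the switchings below.\<close>

lemma private_nbrs:
  assumes "finite V" "E \<subseteq> [V]\<^bsup>2\<^esup>"
  shows "degree E y + card (nbrs E x - nbrs E y - {y}) = degree E x + card (nbrs E y - nbrs E x - {x})"
proof -
  have *: "degree E y = card (nbrs E x \<inter> nbrs E y) + of_bool (x \<in> nbrs E y) + card (nbrs E y - nbrs E x - {x})"
    for x y
  proof -
    note fin = finite_nbrs[OF assms]
    have "nbrs E y = (nbrs E x \<inter> nbrs E y) \<union> (nbrs E y \<inter> {x}) \<union> (nbrs E y - nbrs E x - {x})"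
      by auto
    moreover have "card \<dots> = card ((nbrs E x \<inter> nbrs E y) \<union> (nbrs E y \<inter> {x})) + card (nbrs E y - nbrs E x - {x})"
      using fin by (intro card_Un_disjoint) auto
    moreover have "card ((nbrs E x \<inter> nbrs E y) \<union> (nbrs E y \<inter> {x})) = card (nbrs E x \<inter> nbrs E y) + card (nbrs E y \<inter> {x})"
      using fin nbrs_subset[OF assms(2), of x] by (intro card_Un_disjoint) auto
    moreover have "card (nbrs E y \<inter> {x}) = of_bool (x \<in> nbrs E y)" by auto
    ultimately show ?thesis using degree_eq_card_nbrs[OF assms(2)] by simp
  qed
  show ?thesis
    using *[of x y] *[of y x] nbrs_sym[of x E y] by (simp add: Int_commute)
qed

text \<open>The classical 2-switch: each of the four endpoints loses one edge and gains one.\<close>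

lemma switch:
  assumes V: "finite V" "E \<subseteq> [V]\<^bsup>2\<^esup>"
    and edges: "{a, p} \<in> E" "{b, m} \<in> E" and nonedges: "{a, m} \<notin> E" "{b, p} \<notin> E" "a \<noteq> m" "b \<noteq> p"
  defines "F \<equiv> insert {a, m} (insert {b, p} (E - {{a, p}} - {{b, m}}))"
  shows "F \<subseteq> [V]\<^bsup>2\<^esup>" "degree F = degree E"
proof -
  have mem: "a \<in> V" "p \<in> V" "b \<in> V" "m \<in> V" "a \<noteq> p" "b \<noteq> m"
    using edges edgesD[OF V(2)] by blast+
  \<comment> \<open>With \<open>a = b\<close> or \<open>p = m\<close>, an edge would coincide with a
    non-edge.\<close>
  have ne: "a \<noteq> b" "p \<noteq> m" using edges nonedges by auto
  show "F \<subseteq> [V]\<^bsup>2\<^esup>"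
    unfolding F_def using V(2) mem nonedges nsets2_iff[of a m V] nsets2_iff[of b p V] by auto
  have fin: "finite E" using finite_edges V by blast
  show "degree F = degree E"
  proof
    fix v
    have 1: "degree E v = degree (E - {{a, p}}) v + of_bool (v \<in> {a, p})"
      using fin edges by (intro degree_remove)
    have 2: "degree (E - {{a, p}}) v = degree (E - {{a, p}} - {{b, m}}) v + of_bool (v \<in> {b, m})"
      using fin edges ne mem nonedges by (intro degree_remove) (auto simp: doubleton_eq_iff)
    have 3: "degree (insert {b, p} (E - {{a, p}} - {{b, m}})) v
        = degree (E - {{a, p}} - {{b, m}}) v + of_bool (v \<in> {b, p})"
      using fin nonedges by (intro degree_insert) auto
    have 4: "degree F v = degree (insert {b, p} (E - {{a, p}} - {{b, m}})) v + of_bool (v \<in> {a, m})"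
      unfolding F_def using fin nonedges ne mem
      by (intro degree_insert) (auto simp: doubleton_eq_iff)
    show "degree F v = degree E v"
      using 1 2 3 4 mem ne nonedges by (auto simp: of_bool_def)
  qed
qed

text \<open>The Havel-Hakimi argument: take a realization whose neighbours of \<open>v\<close> have
  the largest degree sum. A non-neighbour \<open>y\<close> of larger degree than a neighbour
  \<open>x\<close> would have a private neighbour \<open>z\<close>, and trading the edges
  \<open>vx\<close>, \<open>zy\<close> for \<open>vy\<close>, \<open>zx\<close> would increase the
  sum.\<close>

lemma top_nbrs_realization:
  assumes V: "finite V" "E \<subseteq> [V]\<^bsup>2\<^esup>"
  obtains F where "F \<subseteq> [V]\<^bsup>2\<^esup>" "degree F = degree E"
    "\<And>x y. x \<in> nbrs F v \<Longrightarrow> y \<in> V \<Longrightarrow> y \<notin> nbrs F v \<Longrightarrow> y \<noteq> v \<Longrightarrow> degree E y \<le> degree E x"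
proof -
  let ?P = "\<lambda>F. F \<subseteq> [V]\<^bsup>2\<^esup> \<and> degree F = degree E"
  let ?f = "\<lambda>F. \<Sum>x\<in>nbrs F v. degree E x"
  have "?f F \<le> (\<Sum>x\<in>V. degree E x)" if "?P F" for F
    using nbrs_subset[of F V v] that V by (intro sum_mono2) auto
  then have "\<exists>F. ?P F \<and> (\<forall>F'. ?P F' \<longrightarrow> ?f F' \<le> ?f F)"
    using V(2) by (intro ex_has_greatest_nat[of ?P E ?f "Suc (\<Sum>x\<in>V. degree E x)"])
      (auto simp: less_Suc_eq_le)
  then obtain F where F: "?P F" and max: "\<And>F'. ?P F' \<Longrightarrow> ?f F' \<le> ?f F"
    by blast
  have "degree E y \<le> degree E x"
    if x: "x \<in> nbrs F v" and y: "y \<in> V" "y \<notin> nbrs F v" "y \<noteq> v" for x y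
  proof (rule ccontr)
    assume "\<not> degree E y \<le> degree E x"
    then have "card (nbrs F y - nbrs F x - {x}) \<noteq> 0"
      using private_nbrs[of V F x y] F V by auto
    then obtain z where z: "z \<in> nbrs F y" "z \<notin> nbrs F x" "z \<noteq> x"
      by (metis Diff_iff card.empty ex_in_conv singletonI)
    have zv: "z \<noteq> v" using z y nbrs_sym by metis
    have xy: "x \<noteq> y" using x y by auto
    have xv: "x \<noteq> v" using x F nbrs_subset[of F V v] by auto
    define F' where "F' = insert {v, y} (insert {z, x} (F - {{v, x}} - {{z, y}}))"
    have "?P F'"
      using switch[of V F v x z y] V F x y z unfolding F'_def nbrs_def
      by (simp add: insert_commute)
    moreover have "nbrs F' v = insert y (nbrs F v - {x})"
      unfolding F'_def nbrs_def using zv xy xv y by (auto simp: doubleton_eq_iff)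
    moreover have "finite (nbrs F v)" using F V finite_nbrs[of V F v] by simp
    ultimately have "?f F' = degree E y + (?f F - degree E x)" "degree E x \<le> ?f F"
      using x y by (auto simp: sum_diff1_nat intro: member_le_sum)
    then show False using max[OF \<open>?P F'\<close>] \<open>\<not> degree E y \<le> degree E x\<close> by simp
  qed
  with F that show thesis by blast
qed

text \<open>Induction on the number of edges from \<open>b\<close> into \<open>I\<close>. A switch
  hands the edge from \<open>b\<close> to some \<open>m\<close> in \<open>I\<close> over to
  \<open>a\<close>, paying with a private neighbour \<open>p\<close> of \<open>a\<close> outside
  \<open>I\<close>. Both cardinalities in the last assumption drop by one, so the supply of such
  \<open>p\<close> lasts.\<close>

lemma independent_exchange_aux:
  assumes V: "finite V" and "E \<subseteq> [V]\<^bsup>2\<^esup>" and I: "a \<notin> I" "b \<notin> I"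
    and "\<And>e. e \<in> E \<Longrightarrow> \<not> e \<subseteq> I" "nbrs E a \<inter> nbrs E b \<inter> I = {}"
    and "card (nbrs E b \<inter> I) \<le> card (nbrs E a - nbrs E b - {b} - I)"
  shows "\<exists>F. F \<subseteq> [V]\<^bsup>2\<^esup> \<and> degree F = degree E \<and> (\<forall>e\<in>F. \<not> e \<subseteq> insert b I)"
  using assms(2,5-)
proof (induction "card (nbrs E b \<inter> I)" arbitrary: E)
  case 0
  then have b: "nbrs E b \<inter> I = {}" using V finite_nbrs by fastforce
  have "\<not> e \<subseteq> insert b I" if e: "e \<in> E" for e
  proof
    assume sub: "e \<subseteq> insert b I"
    obtain x y where xy: "e = {x, y}" "x \<noteq> y"
      using e 0(2) nsets2_cases by blast
    then have "x \<in> I \<and> y \<in> I \<or> x = b \<and> y \<in> nbrs E b \<inter> I \<or> y = b \<and> x \<in> nbrs E b \<inter> I"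
      using sub e by (auto simp: nbrs_def insert_commute)
    then show False using b 0(3) e xy by auto
  qed
  with 0 show ?case by blast
next
  case (Suc n)
  note fin = finite_nbrs[OF V Suc(3)]
  have "nbrs E b \<inter> I \<noteq> {}" "nbrs E a - nbrs E b - {b} - I \<noteq> {}"
    using Suc(2,6) by (metis card.empty nat.distinct(1), metis card.empty le_zero_eq nat.distinct(1))
  then obtain m p where m: "m \<in> nbrs E b" "m \<in> I"
    and p: "p \<in> nbrs E a" "p \<notin> nbrs E b" "p \<noteq> b" "p \<notin> I"
    by blast
  have ma: "m \<notin> nbrs E a" using m Suc(5) by blast
  have ne: "a \<noteq> b" "p \<noteq> m" "a \<noteq> m" "b \<noteq> m" "p \<noteq> a" "p \<noteq> b"
    using m p ma I nbrs_subset[OF Suc(3), of a] by auto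
  define F where "F = insert {a, m} (insert {b, p} (E - {{a, p}} - {{b, m}}))"
  have F: "F \<subseteq> [V]\<^bsup>2\<^esup>" "degree F = degree E"
    using switch[OF V Suc(3), of a p b m] m p ma ne unfolding F_def by (auto simp: nbrs_def)
  have nb: "nbrs F b = insert p (nbrs E b - {m})" and na: "nbrs F a = insert m (nbrs E a - {p})"
    unfolding F_def nbrs_def using ne by (auto simp: doubleton_eq_iff)
  have "nbrs F b \<inter> I = nbrs E b \<inter> I - {m}" using nb p by auto
  then have card_b: "card (nbrs F b \<inter> I) = n"
    using Suc(2) m fin by (simp add: card_Diff_singleton)
  have "nbrs F a - nbrs F b - {b} - I = (nbrs E a - nbrs E b - {b} - I) - {p}"
    using na nb m ma by auto
  then have "card (nbrs F a - nbrs F b - {b} - I) = card (nbrs E a - nbrs E b - {b} - I) - 1"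
    using p fin by (simp add: card_Diff_singleton)
  then have "card (nbrs F b \<inter> I) \<le> card (nbrs F a - nbrs F b - {b} - I)"
    using Suc(2,6) card_b by simp
  moreover have "nbrs F a \<inter> nbrs F b \<inter> I = {}"
    using na nb p Suc(5) by auto
  moreover have "\<not> e \<subseteq> I" if "e \<in> F" for e
    using that Suc(4) I unfolding F_def by auto
  ultimately show ?case
    using Suc(1)[of F] F card_b by auto
qed

text \<open>As \<open>a\<close> lies in the independent set, the neighbours of \<open>b\<close> in
  \<open>I - {a}\<close> are private to \<open>b\<close>, and those of \<open>a\<close> lie outside
  \<open>I\<close>. Since the degree of \<open>a\<close> is at least that of \<open>b\<close>, there
  are enough private neighbours of \<open>a\<close> to move every edge from \<open>b\<close> into
  the set over to \<open>a\<close>.\<close>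

lemma independent_exchange:
  assumes V: "finite V" "E \<subseteq> [V]\<^bsup>2\<^esup>" and I: "a \<in> I" "b \<notin> I" "\<And>e. e \<in> E \<Longrightarrow> \<not> e \<subseteq> I"
    and "degree E b \<le> degree E a"
  obtains F where "F \<subseteq> [V]\<^bsup>2\<^esup>" "degree F = degree E" "\<And>e. e \<in> F \<Longrightarrow> \<not> e \<subseteq> insert b (I - {a})"
proof -
  have a: "nbrs E a \<inter> (I - {a}) = {}"
  proof (rule ccontr)
    assume "nbrs E a \<inter> (I - {a}) \<noteq> {}"
    then obtain x where "{a, x} \<in> E" "x \<in> I" by (auto simp: nbrs_def)
    then show False using I(1) I(3)[of "{a, x}"] by simp
  qed
  have "card (nbrs E b \<inter> (I - {a})) \<le> card (nbrs E b - nbrs E a - {a})"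
    using a finite_nbrs[OF V] by (intro card_mono) auto
  also have "\<dots> \<le> card (nbrs E a - nbrs E b - {b})"
    using private_nbrs[OF V, of a b] assms(6) by simp
  also have "nbrs E a - nbrs E b - {b} = nbrs E a - nbrs E b - {b} - (I - {a})"
    using a by auto
  finally obtain F where "F \<subseteq> [V]\<^bsup>2\<^esup>" "degree F = degree E" "\<forall>e\<in>F. \<not> e \<subseteq> insert b (I - {a})"
    using independent_exchange_aux[OF V, of a "I - {a}" b] a I by blast
  then show thesis using that by blast
qed

subsection \<open>Realizations with an independent set\<close>

text \<open>Among the graphs with as many edges as \<open>E\<close>, take one with least total
  deviation from \<open>r\<close>. If \<open>i\<close> has too many edges and \<open>j\<close> too
  few, then \<open>i\<close> has a private neighbour \<open>p\<close>, and replacing the edge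
  \<open>ip\<close> by \<open>jp\<close> reduces the deviation.\<close>

lemma near_regular_realization:
  fixes r :: "'a \<Rightarrow> int"
  assumes W: "finite W" "E \<subseteq> [W]\<^bsup>2\<^esup>" and sum: "(\<Sum>w\<in>W. r w) = 2 * int (card E)"
    and near: "\<And>w w'. w \<in> W \<Longrightarrow> w' \<in> W \<Longrightarrow> r w \<le> r w' + 1"
  obtains F where "F \<subseteq> [W]\<^bsup>2\<^esup>" "\<And>w. w \<in> W \<Longrightarrow> int (degree F w) = r w"
proof -
  let ?P = "\<lambda>F. F \<subseteq> [W]\<^bsup>2\<^esup> \<and> card F = card E"
  let ?f = "\<lambda>F. \<Sum>w\<in>W. nat \<bar>int (degree F w) - r w\<bar>"
  have "\<exists>F. ?P F \<and> (\<forall>F'. ?P F' \<longrightarrow> ?f F \<le> ?f F')"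
    using W(2) by (intro ex_has_least_nat[of ?P E ?f]) auto
  then obtain F where F: "F \<subseteq> [W]\<^bsup>2\<^esup>" "card F = card E" and min: "\<And>F'. ?P F' \<Longrightarrow> ?f F \<le> ?f F'"
    by blast
  have finF: "finite F" using F W finite_edges[of W F] by blast
  have sum0: "(\<Sum>w\<in>W. int (degree F w) - r w) = 0"
  proof -
    have "int (\<Sum>w\<in>W. degree F w) = 2 * int (card E)"
      using handshake[OF W(1) F(1)] F(2) by simp
    then show ?thesis using sum by (simp add: sum_subtractf)
  qed
  have "int (degree F w) = r w" if "w \<in> W" for w
  proof (rule ccontr)
    assume ne: "int (degree F w) \<noteq> r w"
    \<comment> \<open>The deviations sum to zero, so a nonzero one forces deviations of both
      signs.\<close>
    have "\<exists>i\<in>W. int (degree F i) - r i > 0"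
    proof (rule ccontr)
      assume "\<not> ?thesis"
      then have "\<forall>i\<in>W. 0 \<le> - (int (degree F i) - r i)" by force
      moreover have "(\<Sum>w\<in>W. - (int (degree F w) - r w)) = 0" using sum0 by (simp only: sum_negf)
      ultimately have "\<forall>i\<in>W. - (int (degree F i) - r i) = 0"
        using sum_nonneg_eq_0_iff[OF W(1), of "\<lambda>i. - (int (degree F i) - r i)"] by blast
      then show False using ne that by force
    qed
    then obtain i where i: "i \<in> W" "int (degree F i) > r i" by force
    have "\<exists>j\<in>W. int (degree F j) - r j < 0"
    proof (rule ccontr)
      assume "\<not> ?thesis"
      then have "\<forall>i\<in>W. 0 \<le> int (degree F i) - r i" by force
      then have "\<forall>i\<in>W. int (degree F i) - r i = 0"
        using sum_nonneg_eq_0_iff[OF W(1), of "\<lambda>i. int (degree F i) - r i"] sum0 by blast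
      then show False using ne that by force
    qed
    then obtain j where j: "j \<in> W" "int (degree F j) < r j" by force
    have ij: "i \<noteq> j" using i j by auto
    \<comment> \<open>By integrality,
      \<open>degree F j \<le> r j - 1 \<le> r i < degree F i\<close>.\<close>
    have "degree F j < degree F i" using i j near[OF j(1) i(1)] by linarith
    then have "card (nbrs F i - nbrs F j - {j}) \<noteq> 0"
      using private_nbrs[OF W(1) F(1), of i j] by linarith
    then obtain p where p: "p \<in> nbrs F i" "p \<notin> nbrs F j" "p \<noteq> j"
      by (metis Diff_iff card.empty ex_in_conv singletonI)
    have pi: "{i, p} \<in> F" "{j, p} \<notin> F" "p \<in> W" "p \<noteq> i"
      using p nbrs_subset[OF F(1), of i] by (auto simp: nbrs_def)
    define F' where "F' = insert {j, p} (F - {{i, p}})"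
    have "?P F'"
      unfolding F'_def using F pi p j nsets2_iff[of j p W] finF card_Suc_Diff1[of F "{i, p}"]
      by auto
    have deg: "int (degree F' v) = int (degree F v) + of_bool (v = j) - of_bool (v = i)" for v
    proof -
      have "degree F' v = degree (F - {{i, p}}) v + of_bool (v \<in> {j, p})"
        unfolding F'_def using finF pi by (intro degree_insert) auto
      moreover have "degree F v = degree (F - {{i, p}}) v + of_bool (v \<in> {i, p})"
        using finF pi by (intro degree_remove)
      ultimately show ?thesis using p pi ij by (auto simp: of_bool_def)
    qed
    have "?f F' < ?f F"
      by (rule sum_strict_mono_ex1[OF W(1)]) (use deg i j in \<open>auto simp: of_bool_def\<close>)
    then show False using min[OF \<open>?P F'\<close>] by simp
  qed
  with F(1) that show thesis by blast
qed

lemma sum_card_incidence: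
  assumes "finite K" "finite W" "\<And>u. u \<in> K \<Longrightarrow> N u \<subseteq> W"
  shows "(\<Sum>w\<in>W. card {u \<in> K. w \<in> N u}) = (\<Sum>u\<in>K. card (N u))"
proof -
  have "(\<Sum>w\<in>W. card {u \<in> K. w \<in> N u}) = (\<Sum>w\<in>W. \<Sum>u\<in>K. of_bool (w \<in> N u))"
    using assms by (simp add: of_bool_def sum.If_cases Int_def)
  also have "\<dots> = (\<Sum>u\<in>K. \<Sum>w\<in>W. of_bool (w \<in> N u))" by (rule sum.swap)
  also have "\<dots> = (\<Sum>u\<in>K. card (W \<inter> N u))"
    using assms by (simp add: of_bool_def sum.If_cases Int_def)
  also have "\<dots> = (\<Sum>u\<in>K. card (N u))"
    using assms by (intro sum.cong) (auto simp: Int_absorb1)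
  finally show ?thesis .
qed

text \<open>
  The neighbourhoods minimize the sum of squares of the residual degrees. If some residual exceeded
  another by 2, the vertices of maximal residual would all have degree above \<open>g\<close>; but a suitable
  exchange keeps the sum of squares and moves the maximum to a vertex of degree \<open>g\<close>.
\<close>

lemma balanced_neighbourhoods:
  fixes c :: "'a \<Rightarrow> nat"
  assumes fin: "finite K" "finite W"
    and cW: "\<And>w. w \<in> W \<Longrightarrow> g \<le> c w"
    and cK: "\<And>u. u \<in> K \<Longrightarrow> card {w \<in> W. g < c w} \<le> c u" "\<And>u. u \<in> K \<Longrightarrow> c u \<le> card W"
    and high: "\<And>w. w \<in> W \<Longrightarrow> g < c w \<Longrightarrow> c w \<le> card K"
    and sums: "(\<Sum>u\<in>K. c u) \<le> (\<Sum>w\<in>W. c w)"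
  obtains N where "\<And>u. u \<in> K \<Longrightarrow> N u \<subseteq> W \<and> card (N u) = c u"
    "\<And>w w'. w \<in> W \<Longrightarrow> w' \<in> W \<Longrightarrow>
       int (c w) - int (card {u \<in> K. w \<in> N u}) \<le> int (c w') - int (card {u \<in> K. w' \<in> N u}) + 1"
proof -
  define P where "P N \<longleftrightarrow> (\<forall>u\<in>K. N u \<subseteq> W \<and> card (N u) = c u)" for N
  define r where "r N w = int (c w) - int (card {u \<in> K. w \<in> N u})" for N w
  define Q where "Q N = (\<Sum>w\<in>W. (r N w)\<^sup>2)" for N
  define M where "M N \<longleftrightarrow> P N \<and> (\<forall>N'. P N' \<longrightarrow> Q N \<le> Q N')" for N
  have sum_r: "(\<Sum>w\<in>W. r N w) \<ge> 0" if "P N" for N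
  proof -
    have "(\<Sum>w\<in>W. card {u \<in> K. w \<in> N u}) = (\<Sum>u\<in>K. c u)"
      using sum_card_incidence[OF fin, of N] that by (simp add: P_def)
    then have "(\<Sum>w\<in>W. r N w) = int (\<Sum>w\<in>W. c w) - int (\<Sum>u\<in>K. c u)"
      by (simp add: r_def sum_subtractf flip: of_nat_sum)
    then show ?thesis using sums by (simp del: of_nat_sum)
  qed
  have ex: "\<exists>N. P N"
  proof -
    have "\<forall>u\<in>K. \<exists>A. A \<subseteq> W \<and> card A = c u"
      using cK(2) by (meson obtain_subset_with_card_n)
    then show ?thesis unfolding P_def by (rule bchoice)
  qed
  \<comment> \<open>Replacing \<open>w'\<close> by \<open>w\<close> in one neighbourhood shifts a
    unit of residual from \<open>w\<close> to \<open>w'\<close>. The sum of squares drops if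
    \<open>w\<close> exceeds \<open>w'\<close> by at least 2 and is unchanged if it exceeds it by
    exactly 1.\<close>
  have move: "P N' \<and> (\<forall>x. r N' x = r N x - of_bool (x = w) + of_bool (x = w')) \<and> Q N' = Q N - 2 * (r N w - r N w' - 1)"
    if N: "P N" and u: "u \<in> K" and w: "w' \<in> N u" "w \<in> W" "w \<notin> N u" and N': "N' = N(u := insert w (N u - {w'}))"
    for N N' u w w'
  proof -
    have Nu: "N u \<subseteq> W" "card (N u) = c u" using N u by (auto simp: P_def)
    have finN: "finite (N u)" using Nu fin finite_subset by blast
    have w'W: "w' \<in> W" "w \<noteq> w'" using Nu w by auto
    have "card (insert w (N u - {w'})) = c u"
      using Nu finN w card_Suc_Diff1[of "N u" w'] by simp
    then have PN': "P N'" using N Nu w unfolding P_def N' by auto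
    have r': "r N' x = r N x - of_bool (x = w) + of_bool (x = w')" for x
    proof -
      consider "x = w" | "x = w'" | "x \<noteq> w" "x \<noteq> w'" by blast
      then show ?thesis
      proof cases
        case 1
        have "{u' \<in> K. x \<in> N' u'} = insert u {u' \<in> K. x \<in> N u'}" using 1 u w N' by auto
        then have "card {u' \<in> K. x \<in> N' u'} = Suc (card {u' \<in> K. x \<in> N u'})"
          using fin w 1 by simp
        then show ?thesis using 1 w'W by (simp add: r_def)
      next
        case 2
        have "{u' \<in> K. x \<in> N u'} = insert u {u' \<in> K. x \<in> N' u'}" using 2 u w N' by auto
        moreover have "u \<notin> {u' \<in> K. x \<in> N' u'}" using 2 w'W N' by auto
        ultimately have "card {u' \<in> K. x \<in> N u'} = Suc (card {u' \<in> K. x \<in> N' u'})"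
          using fin by simp
        then show ?thesis using 2 w'W by (simp add: r_def)
      next
        case 3
        then have "{u' \<in> K. x \<in> N u'} = {u' \<in> K. x \<in> N' u'}" using N' by auto
        then show ?thesis using 3 by (simp add: r_def)
      qed
    qed
    have "Q N' - Q N = (\<Sum>x\<in>W. (r N' x)\<^sup>2 - (r N x)\<^sup>2)"
      by (simp add: Q_def sum_subtractf)
    also have "\<dots> = (\<Sum>x\<in>W. (if x = w then 1 - 2 * r N w else 0) + (if x = w' then 1 + 2 * r N w' else 0))"
      using w'W by (intro sum.cong) (auto simp: r' power2_eq_square algebra_simps)
    also have "\<dots> = (1 - 2 * r N w) + (1 + 2 * r N w')"
      using fin w w'W by (simp add: sum.distrib)
    finally show ?thesis using PN' r' by simp
  qed
  have exM: "\<exists>N. M N"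
  proof -
    obtain N0 where N0: "P N0" using ex by blast
    have "\<exists>N. P N \<and> (\<forall>N'. P N' \<longrightarrow> nat (Q N) \<le> nat (Q N'))"
      using N0 ex_has_least_nat[of P N0 "\<lambda>N. nat (Q N)"] by blast
    moreover have "nat (Q N) \<le> nat (Q N') \<longleftrightarrow> Q N \<le> Q N'" for N N'
      by (simp add: Q_def sum_nonneg nat_le_eq_zle nat_le_iff)
    ultimately show ?thesis unfolding M_def by simp
  qed
  have low: "r N w \<le> r N w' + 1"
    if "M N" "u \<in> K" "w' \<in> N u" "w \<in> W" "w \<notin> N u" for N u w w'
    using move[of N u w' w "N(u := insert w (N u - {w'}))"] that unfolding M_def by force
  \<comment> \<open>By \<open>low\<close>, every \<open>u\<close> that chose \<open>w'\<close> also
    chose \<open>w\<close>. So the gap of 2 between the residuals already exists between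
    \<open>c w\<close> and \<open>c w'\<close>, and \<open>c w' \<ge> g\<close>.\<close>
  have gap: "g < c w" if N: "M N" and w: "w \<in> W" "w' \<in> W" "r N w \<ge> r N w' + 2" for N w w'
  proof -
    have "card {u \<in> K. w' \<in> N u} \<le> card {u \<in> K. w \<in> N u}"
      using low[OF N _ _ w(1)] w fin by (intro card_mono) force+
    then show ?thesis using w cW[of w'] by (simp add: r_def)
  qed
  obtain N where N: "M N" using exM by blast
  have "r N w \<le> r N w' + 1" if w: "w \<in> W" "w' \<in> W" for w w'
  proof (rule ccontr)
    assume less: "\<not> ?thesis"
    have "r N ` W \<noteq> {}" "finite (r N ` W)" using w fin by auto
    then obtain v where v: "v \<in> W" "\<And>x. x \<in> W \<Longrightarrow> r N x \<le> r N v"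
      using Max_in[of "r N ` W"] Max_ge[of "r N ` W"] by (smt (verit) imageE imageI)
    have vw': "r N v \<ge> r N w' + 2" using less v(2)[OF w(1)] by simp
    have gv: "g < c v" using gap[OF N v(1) w(2) vw'] .
    \<comment> \<open>The residuals have nonnegative sum and \<open>w'\<close> lies strictly below
      their maximum. Positivity of the maximum, together with \<open>high\<close>, yields a
      \<open>u\<close> that did not choose \<open>v\<close>.\<close>
    have "r N v > 0"
    proof (rule ccontr)
      assume "\<not> r N v > 0"
      then have "\<forall>x\<in>W. r N x \<le> 0" "r N w' < 0" using v vw' by force+
      then have "(\<Sum>x\<in>W. r N x) < (\<Sum>x\<in>W. 0)"
        using fin w by (intro sum_strict_mono_ex1) auto
      then show False using sum_r[of N] N by (simp add: M_def)
    qed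
    then have "card {u \<in> K. v \<in> N u} < card K" using high[OF v(1) gv] by (simp add: r_def)
    then have "{u \<in> K. v \<in> N u} \<noteq> K" by auto
    then obtain u where u: "u \<in> K" "v \<notin> N u" by blast
    have Nu: "N u \<subseteq> W" "card (N u) = c u" using N u by (auto simp: M_def P_def)
    \<comment> \<open>\<open>N u\<close> has at least as many elements as there are vertices above
      \<open>g\<close> and omits one of these, \<open>v\<close>. So it contains an \<open>x\<close>
      that is not above \<open>g\<close>.\<close>
    have "\<not> N u \<subseteq> {w \<in> W. g < c w} - {v}"
    proof
      assume "N u \<subseteq> {w \<in> W. g < c w} - {v}"
      then have "card (N u) \<le> card ({w \<in> W. g < c w} - {v})" using fin by (intro card_mono) auto
      also have "\<dots> < card {w \<in> W. g < c w}"
        using fin v gv by (intro card_Diff1_less) auto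
      finally show False using cK(1)[OF u(1)] Nu by simp
    qed
    then obtain x where x: "x \<in> N u" "\<not> g < c x" using u Nu by auto
    have xW: "x \<in> W" using x Nu by auto
    have "r N x \<ge> r N v - 1" using low[OF N u(1) x(1) v(1) u(2)] by simp
    moreover have "r N x < r N w' + 2" using gap[OF N xW w(2)] x by force
    ultimately have rx: "r N x = r N v - 1" using vw' by linarith
    \<comment> \<open>Since the residual of \<open>x\<close> is squeezed to one below the maximum,
      this swap preserves minimality and raises \<open>x\<close> to the old maximum. Then
      \<open>gap\<close> would put \<open>x\<close> above \<open>g\<close>.\<close>
    define N' where "N' = N(u := insert v (N u - {x}))"
    have N': "P N'" "\<And>y. r N' y = r N y - of_bool (y = v) + of_bool (y = x)" "Q N' = Q N"
      using move[of N u x v N'] N u x v rx by (auto simp: M_def N'_def)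
    have "M N'" using N N' by (auto simp: M_def)
    moreover have "r N' x \<ge> r N' w' + 2" using N'(2) rx vw' u(2) x by (auto simp: of_bool_def)
    ultimately show False using gap[of N' x w'] xW w x by blast
  qed
  moreover have "N u \<subseteq> W \<and> card (N u) = c u" if "u \<in> K" for u
    using N that by (simp add: M_def P_def)
  ultimately show thesis using that[of N] by (simp add: r_def)
qed

text \<open>The threshold \<open>g\<close> separates the low degrees in \<open>K\<close> from those
  in the rest \<open>W\<close>. Balanced neighbourhoods join \<open>K\<close> to \<open>W\<close>
  only; the residual degrees on \<open>W\<close> then differ by at most one, and
  \<open>near_regular_realization\<close> supplies the edges inside \<open>W\<close>.\<close>

lemma independent_realization_core:
  assumes V: "finite V" "E \<subseteq> [V]\<^bsup>2\<^esup>" and K: "K \<subseteq> V" "card K \<le> card (V - K)"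
    and cK: "\<And>u. u \<in> K \<Longrightarrow> degree E u \<le> g" "\<And>u. u \<in> K \<Longrightarrow> degree E u \<le> card (V - K)"
      "\<And>u. u \<in> K \<Longrightarrow> card {w \<in> V - K. g < degree E w} \<le> degree E u"
    and cW: "\<And>w. w \<in> V - K \<Longrightarrow> g \<le> degree E w"
      "\<And>w. w \<in> V - K \<Longrightarrow> g < degree E w \<Longrightarrow> degree E w \<le> card K"
  shows "\<exists>F. F \<subseteq> [V]\<^bsup>2\<^esup> \<and> degree F = degree E \<and> (\<forall>e\<in>F. \<not> e \<subseteq> K)"
proof -
  define W where "W = V - K"
  have fin: "finite K" "finite W" "finite E"
    using V K finite_subset finite_edges[of V E] by (auto simp: W_def)
  have "(\<Sum>u\<in>K. degree E u) \<le> card K * g" using cK(1) sum_bounded_above[of K "degree E" g] by simp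
  also have "\<dots> \<le> card W * g" using K by (simp add: W_def)
  also have "\<dots> \<le> (\<Sum>w\<in>W. degree E w)" using cW(1) sum_bounded_below[of W g "degree E"] by (simp add: W_def)
  finally have sums: "(\<Sum>u\<in>K. degree E u) \<le> (\<Sum>w\<in>W. degree E w)" .
  obtain N where N: "\<And>u. u \<in> K \<Longrightarrow> N u \<subseteq> W \<and> card (N u) = degree E u"
    and bal: "\<And>w w'. w \<in> W \<Longrightarrow> w' \<in> W \<Longrightarrow>
       int (degree E w) - int (card {u \<in> K. w \<in> N u}) \<le> int (degree E w') - int (card {u \<in> K. w' \<in> N u}) + 1"
    by (rule balanced_neighbourhoods[OF fin(1,2), of g "degree E"]) (use cK cW sums in \<open>auto simp: W_def\<close>)
  define r where "r w = int (degree E w) - int (card {u \<in> K. w \<in> N u})" for w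
  have "(\<Sum>w\<in>W. card {u \<in> K. w \<in> N u}) = (\<Sum>u\<in>K. degree E u)"
    using sum_card_incidence[OF fin(1,2), of N] N by simp
  then have sum_r': "(\<Sum>w\<in>W. r w) = int (\<Sum>w\<in>W. degree E w) - int (\<Sum>u\<in>K. degree E u)"
    by (simp add: r_def sum_subtractf flip: of_nat_sum)
  also have "\<dots> = (\<Sum>e\<in>E. int (card (e \<inter> W)) - int (card (e \<inter> K)))"
    using fin by (simp add: sum_degree_eq sum_subtractf)
  \<comment> \<open>Edges between \<open>K\<close> and \<open>W\<close> cancel, so the residual sum
    is twice the surplus of edges inside \<open>W\<close> over edges inside
    \<open>K\<close>.\<close>
  also have "\<dots> = (\<Sum>e\<in>E. 2 * of_bool (e \<subseteq> W) - 2 * of_bool (e \<subseteq> K))"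
  proof (intro sum.cong refl)
    fix e assume "e \<in> E"
    then obtain x y where e: "e = {x, y}" "x \<in> V" "y \<in> V" "x \<noteq> y" using V nsets2_cases by blast
    show "int (card (e \<inter> W)) - int (card (e \<inter> K)) = 2 * of_bool (e \<subseteq> W) - 2 * of_bool (e \<subseteq> K)"
      using e by (auto simp: W_def)
  qed
  also have "\<dots> = 2 * (int (card {e \<in> E. e \<subseteq> W}) - int (card {e \<in> E. e \<subseteq> K}))"
    using fin by (simp add: sum_subtractf of_bool_def sum.If_cases Int_def flip: sum_distrib_left)
  finally have sum_r: "(\<Sum>w\<in>W. r w) = 2 * (int (card {e \<in> E. e \<subseteq> W}) - int (card {e \<in> E. e \<subseteq> K}))" .
  have "card {e \<in> E. e \<subseteq> K} \<le> card {e \<in> E. e \<subseteq> W}" using sum_r sum_r' sums by (simp del: of_nat_sum)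
  \<comment> \<open>\<open>E0\<close> witnesses that a graph on \<open>W\<close> can have as many
    edges as half the residual sum.\<close>
  then obtain E0 where E0: "E0 \<subseteq> {e \<in> E. e \<subseteq> W}" "card E0 = card {e \<in> E. e \<subseteq> W} - card {e \<in> E. e \<subseteq> K}"
    by (meson diff_le_self obtain_subset_with_card_n)
  have "E0 \<subseteq> [W]\<^bsup>2\<^esup>" using E0 V by (auto simp: nsets_def)
  moreover have "(\<Sum>w\<in>W. r w) = 2 * int (card E0)"
    using sum_r E0 \<open>card {e \<in> E. e \<subseteq> K} \<le> _\<close> by simp
  ultimately obtain F where F: "F \<subseteq> [W]\<^bsup>2\<^esup>" "\<And>w. w \<in> W \<Longrightarrow> int (degree F w) = r w"
    using near_regular_realization[OF fin(2), of E0 r] bal by (auto simp: r_def)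
  define B where "B = {{u, w} |u w. u \<in> K \<and> w \<in> N u}"
  have WK: "w \<notin> K" if "w \<in> W" for w using that by (simp add: W_def)
  have NW: "w \<in> W" if "w \<in> N u" "u \<in> K" for u w using that N by blast
  have BV: "B \<subseteq> [V]\<^bsup>2\<^esup>"
    using K NW WK unfolding B_def by (fastforce simp: nsets2_iff W_def)
  have FV: "F \<subseteq> [V]\<^bsup>2\<^esup>" using F(1) nsets_mono[of W V 2] by (auto simp: W_def)
  have disj: "F \<inter> B = {}"
  proof (rule ccontr)
    assume "F \<inter> B \<noteq> {}"
    then obtain u w where "{u, w} \<in> F" "u \<in> K" by (auto simp: B_def)
    then show False using edgesD(1)[OF F(1)] WK by blast
  qed
  have B_iff: "{u, w} \<in> B \<longleftrightarrow> (u \<in> K \<and> w \<in> N u) \<or> (w \<in> K \<and> u \<in> N w)" for u w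
    unfolding B_def by (auto simp: doubleton_eq_iff insert_commute)
  have deg: "degree (F \<union> B) v = degree F v + degree B v" for v
    using disj finite_edges[OF V(1) FV] finite_edges[OF V(1) BV] by (simp add: degree_Un_disjoint)
  have "degree (F \<union> B) v = degree E v" for v
  proof -
    consider "v \<in> K" | "v \<in> W" | "v \<notin> V" using W_def by blast
    then show ?thesis
    proof cases
      case 1
      have "nbrs B v = N v" using 1 NW WK by (auto simp: nbrs_def B_iff)
      moreover have "nbrs F v = {}" using 1 WK edgesD(1)[OF F(1)] by (auto simp: nbrs_def)
      ultimately show ?thesis
        using deg N[OF 1] degree_eq_card_nbrs[OF BV] degree_eq_card_nbrs[OF FV] by simp
    next
      case 2
      have "nbrs B v = {u \<in> K. v \<in> N u}" using 2 WK by (auto simp: nbrs_def B_iff)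
      then show ?thesis
        using deg[of v] F(2)[OF 2] degree_eq_card_nbrs[OF BV, of v] by (simp add: r_def)
    next
      case 3
      have "nbrs H v = {}" if "H \<subseteq> [V]\<^bsup>2\<^esup>" for H
        using 3 edgesD(1)[OF that] by (auto simp: nbrs_def)
      then show ?thesis
        using V FV BV degree_eq_card_nbrs[of E V v] degree_eq_card_nbrs[of "F \<union> B" V v] by simp
    qed
  qed
  moreover have "\<not> e \<subseteq> K" if e: "e \<in> F \<union> B" for e
  proof
    assume sub: "e \<subseteq> K"
    have "e \<in> [V]\<^bsup>2\<^esup>" using e BV FV by blast
    then obtain x y where xy: "e = {x, y}" using nsets2_cases by blast
    then show False using sub e edgesD(1)[OF F(1)] WK NW B_iff by auto
  qed
  ultimately show ?thesis using FV BV by (intro exI[of _ "F \<union> B"]) auto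
qed

section \<open>Deleting and restoring a vertex\<close>

lemma degree_delete_vertex:
  assumes "finite V" "E \<subseteq> [V]\<^bsup>2\<^esup>" "w \<noteq> v"
  shows "degree E w = degree {e \<in> E. v \<notin> e} w + of_bool (w \<in> nbrs E v)"
proof -
  have fin: "finite E" using assms finite_edges[of V E] by simp
  have E: "E = {e \<in> E. v \<notin> e} \<union> {e \<in> E. v \<in> e}" by auto
  have "degree E w = degree {e \<in> E. v \<notin> e} w + degree {e \<in> E. v \<in> e} w"
    by (subst E, rule degree_Un_disjoint) (use fin in auto)
  moreover have "degree {e \<in> E. v \<in> e} w = of_bool (w \<in> nbrs E v)"
  proof -
    have "e = {v, w}" if e: "e \<in> E" "v \<in> e" "w \<in> e" for e
    proof -
      obtain x y where "e = {x, y}" using e assms nsets2_cases by blast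
      then show ?thesis using e assms(3) by auto
    qed
    then have "{e \<in> {e \<in> E. v \<in> e}. w \<in> e} = E \<inter> {{v, w}}" by blast
    then show ?thesis by (simp add: degree_def nbrs_def Int_insert_right)
  qed
  ultimately show ?thesis by simp
qed

lemma readd_vertex:
  assumes V: "finite V" "E \<subseteq> [V]\<^bsup>2\<^esup>"
    and F: "F \<subseteq> [V - {v}]\<^bsup>2\<^esup>" "degree F = degree {e \<in> E. v \<notin> e}"
  shows "F \<union> {e \<in> E. v \<in> e} \<subseteq> [V]\<^bsup>2\<^esup>" "degree (F \<union> {e \<in> E. v \<in> e}) = degree E"
proof -
  show sub: "F \<union> {e \<in> E. v \<in> e} \<subseteq> [V]\<^bsup>2\<^esup>"
    using F V nsets_mono[of "V - {v}" V 2] by auto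
  have fin: "finite E" "finite F" using V F finite_edges[of V E] finite_edges[of "V - {v}" F] by auto
  have E: "E = {e \<in> E. v \<notin> e} \<union> {e \<in> E. v \<in> e}" by auto
  have "F \<inter> {e \<in> E. v \<in> e} = {}" using F by (auto simp: nsets_def)
  then have "degree (F \<union> {e \<in> E. v \<in> e}) w = degree {e \<in> E. v \<notin> e} w + degree {e \<in> E. v \<in> e} w" for w
    using fin F(2) by (subst degree_Un_disjoint) auto
  also have "\<dots> w = degree E w" for w
    by (subst (3) E, rule degree_Un_disjoint[symmetric]) (use fin in auto)
  finally show "degree (F \<union> {e \<in> E. v \<in> e}) = degree E" by blast
qed

text \<open>Choose a realization and an independent set of the given size that meets
  \<open>N\<close> as little as possible. If it contains some \<open>a\<close> in \<open>N\<close>,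
  then it cannot contain all of \<open>Z\<close>, which is disjoint from \<open>N\<close> and at
  least as large; exchanging \<open>a\<close> for a missing \<open>b\<close> in \<open>Z\<close>
  improves the choice.\<close>

lemma independent_set_avoiding:
  assumes V: "finite V" "E \<subseteq> [V]\<^bsup>2\<^esup>" and I: "I \<subseteq> V" "\<And>e. e \<in> E \<Longrightarrow> \<not> e \<subseteq> I"
    and Z: "Z \<subseteq> V - N" "card I \<le> card Z" "\<And>z n. z \<in> Z \<Longrightarrow> n \<in> N \<Longrightarrow> degree E z \<le> degree E n"
  shows "\<exists>F J. F \<subseteq> [V]\<^bsup>2\<^esup> \<and> degree F = degree E \<and> J \<subseteq> V - N \<and> card J = card I \<and> (\<forall>e\<in>F. \<not> e \<subseteq> J)"
proof -
  define P where "P n \<longleftrightarrow> (\<exists>F J. F \<subseteq> [V]\<^bsup>2\<^esup> \<and> degree F = degree E \<and> J \<subseteq> V \<and> card J = card I \<and>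
    (\<forall>e\<in>F. \<not> e \<subseteq> J) \<and> card (J \<inter> N) = n)" for n
  have "P (card (I \<inter> N))" using V I unfolding P_def by blast
  then have "P (LEAST n. P n)" by (rule LeastI)
  then obtain F J where F: "F \<subseteq> [V]\<^bsup>2\<^esup>" "degree F = degree E" and J: "J \<subseteq> V" "card J = card I" "\<forall>e\<in>F. \<not> e \<subseteq> J"
    and least: "card (J \<inter> N) = (LEAST n. P n)"
    unfolding P_def by blast
  have finJ: "finite J" using J V finite_subset by blast
  have "J \<inter> N = {}"
  proof (rule ccontr)
    assume "J \<inter> N \<noteq> {}"
    then obtain a where a: "a \<in> J" "a \<in> N" by blast
    have "\<not> Z \<subseteq> J"
    proof
      assume "Z \<subseteq> J"
      then have "Z \<subseteq> J - {a}" using a Z by auto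
      then have "card Z \<le> card (J - {a})" using finJ by (intro card_mono) auto
      also have "\<dots> < card J" using a finJ by (intro card_Diff1_less)
      finally show False using J Z by simp
    qed
    then obtain b where b: "b \<in> Z" "b \<notin> J" by blast
    have "degree F b \<le> degree F a" using F Z(3) a b by simp
    then obtain F' where F': "F' \<subseteq> [V]\<^bsup>2\<^esup>" "degree F' = degree F" "\<And>e. e \<in> F' \<Longrightarrow> \<not> e \<subseteq> insert b (J - {a})"
      using independent_exchange[OF V(1) F(1), of a J b] J a b by blast
    have J': "insert b (J - {a}) \<inter> N = J \<inter> N - {a}" using b Z by auto
    have lt: "card (J \<inter> N - {a}) < card (J \<inter> N)" using a finJ by (intro card_Diff1_less) auto
    have "card (insert b (J - {a})) = card J"
      using a b finJ card_Suc_Diff1[of J a] by simp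
    moreover have "insert b (J - {a}) \<subseteq> V" using J b Z by blast
    ultimately have "P (card (J \<inter> N - {a}))"
      unfolding P_def using F F' J J' by (intro exI[of _ F'] exI[of _ "insert b (J - {a})"]) auto
    then have "(LEAST n. P n) \<le> card (J \<inter> N - {a})" by (rule Least_le)
    then show False using lt least by simp
  qed
  then show ?thesis using F J by blast
qed

text \<open>
  Complementary form of the clique statement. Deleting a vertex whose neighbours have the highest
  possible degrees reduces the number of vertices, unless ties between degrees make
  \<open>independent_realization_core\<close> applicable.
\<close>

lemma independent_realization:
  assumes "finite V" "E \<subseteq> [V]\<^bsup>2\<^esup>" "2 * s \<le> card V" "\<And>v. v \<in> V \<Longrightarrow> degree E v + s \<le> card V"
  shows "\<exists>F I. F \<subseteq> [V]\<^bsup>2\<^esup> \<and> degree F = degree E \<and> I \<subseteq> V \<and> card I = s \<and> (\<forall>e\<in>F. \<not> e \<subseteq> I)"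
  using assms
proof (induction "card V" arbitrary: V E s rule: less_induct)
  case less
  note V = less(2,3)
  have delete: "\<exists>F' I. F' \<subseteq> [V - {v}]\<^bsup>2\<^esup> \<and> degree F' = degree {e \<in> F. v \<notin> e} \<and> I \<subseteq> V - {v} \<and> card I = t
      \<and> (\<forall>e\<in>F'. \<not> e \<subseteq> I)"
    if "v \<in> V" "F \<subseteq> [V]\<^bsup>2\<^esup>" "2 * t \<le> card V - 1" "\<And>w. w \<in> V - {v} \<Longrightarrow> degree {e \<in> F. v \<notin> e} w + t \<le> card V - 1"
    for v F t
  proof (rule less(1))
    show "card (V - {v}) < card V" using V that by (intro card_Diff1_less)
    show "{e \<in> F. v \<notin> e} \<subseteq> [V - {v}]\<^bsup>2\<^esup>" using that(2) by (auto simp: nsets_def)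
  qed (use V that in auto)
  \<comment> \<open>Deletion with the same \<open>s\<close>: the set found in the smaller graph
    avoids \<open>v\<close>, so it stays independent when the edges at \<open>v\<close>
    return.\<close>
  have add: ?case
    if v: "v \<in> V" and F: "F \<subseteq> [V]\<^bsup>2\<^esup>" "degree F = degree E" and s: "2 * s \<le> card V - 1"
      and deg: "\<And>w. w \<in> V - {v} \<Longrightarrow> degree {e \<in> F. v \<notin> e} w + s \<le> card V - 1" for v F
  proof -
    obtain F' I where F': "F' \<subseteq> [V - {v}]\<^bsup>2\<^esup>" "degree F' = degree {e \<in> F. v \<notin> e}"
      and I: "I \<subseteq> V - {v}" "card I = s" "\<forall>e\<in>F'. \<not> e \<subseteq> I"
      using delete[OF v F(1) s deg] by blast
    have "\<forall>e\<in>F' \<union> {e \<in> F. v \<in> e}. \<not> e \<subseteq> I" using I by auto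
    moreover note readd_vertex[OF V(1) F(1) F']
    ultimately show ?case using I F(2)
      by (intro exI[of _ "F' \<union> {e \<in> F. v \<in> e}"] exI[of _ I]) auto
  qed
  consider "s = 0" | "2 * s < card V" | "s > 0" "2 * s = card V" using less(4) by linarith
  then show ?case
  proof cases
    case 1
    have "e \<noteq> {}" if "e \<in> E" for e using that V by (auto simp: nsets_def)
    then show ?thesis using V 1 by (intro exI[of _ E] exI[of _ "{}"]) auto
  next
    case 2
    \<comment> \<open>The largest degree that the hypothesis allows. To delete a vertex with the
      same \<open>s\<close>, all remaining degrees must fall below it.\<close>
    define \<mu> where "\<mu> = card V - s"
    have \<mu>: "degree E v \<le> \<mu>" if "v \<in> V" for v using less(5)[OF that] by (simp add: \<mu>_def)
    show ?thesis
    proof (cases "\<exists>x\<in>V. degree E x = \<mu>")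
      case False
      have "V \<noteq> {}" using 2 by auto
      then obtain x where x: "x \<in> V" by blast
      show ?thesis
      proof (rule add[OF x V(2) refl])
        fix w assume w: "w \<in> V - {x}"
        have "degree {e \<in> E. x \<notin> e} w \<le> degree E w"
          using degree_delete_vertex[OF V, of w x] w by simp
        moreover have "degree E w < \<mu>" using \<mu>[of w] False w by force
        ultimately show "degree {e \<in> E. x \<notin> e} w + s \<le> card V - 1" by (simp add: \<mu>_def)
      qed (use 2 in simp)
    next
      case True
      then obtain x where x: "x \<in> V" "degree E x = \<mu>" by blast
      obtain F where F: "F \<subseteq> [V]\<^bsup>2\<^esup>" "degree F = degree E"
        and top: "\<And>z y. z \<in> nbrs F x \<Longrightarrow> y \<in> V \<Longrightarrow> y \<notin> nbrs F x \<Longrightarrow> y \<noteq> x \<Longrightarrow> degree E y \<le> degree E z"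
        using top_nbrs_realization[OF V, of x] by blast
      show ?thesis
      proof (cases "\<exists>y\<in>V. y \<noteq> x \<and> y \<notin> nbrs F x \<and> degree E y = \<mu>")
        case False
        show ?thesis
        proof (rule add[OF x(1) F])
          fix w assume w: "w \<in> V - {x}"
          have "degree E w = degree {e \<in> F. x \<notin> e} w + of_bool (w \<in> nbrs F x)"
            using degree_delete_vertex[OF V(1) F(1), of w x] w F(2) by simp
          moreover have "w \<in> nbrs F x \<or> degree E w < \<mu>" using \<mu>[of w] False w by force
          ultimately show "degree {e \<in> F. x \<notin> e} w + s \<le> card V - 1"
            using \<mu>[of w] w 2 by (auto simp: \<mu>_def)
        qed (use 2 in simp)
      next
        case True
        then obtain y where y: "y \<in> V" "y \<noteq> x" "y \<notin> nbrs F x" "degree E y = \<mu>" by blast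
        \<comment> \<open>By the choice of \<open>F\<close>, the missed vertex \<open>y\<close> of
          degree \<open>\<mu>\<close> forces degree \<open>\<mu>\<close> on all neighbours of
          \<open>x\<close>. So at least \<open>\<mu> + 2\<close> vertices have degree
          \<open>\<mu>\<close>, all others fit into a set \<open>K\<close> of size \<open>s\<close>,
          and the core lemma applies with threshold \<open>\<mu>\<close>.\<close>
        let ?L = "{v \<in> V. degree E v < \<mu>}"
        have N: "nbrs F x \<subseteq> V - {x}" by (rule nbrs_subset[OF F(1)])
        have finN: "finite (nbrs F x)" by (rule finite_nbrs[OF V(1) F(1)])
        have "card (insert x (insert y (nbrs F x))) = \<mu> + 2"
        proof -
          have "x \<notin> nbrs F x" "card (nbrs F x) = \<mu>"
            using N x F(2) degree_eq_card_nbrs[OF F(1), of x] by auto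
          then show ?thesis using y finN by simp
        qed
        moreover have "?L \<subseteq> V - insert x (insert y (nbrs F x))"
          using x y top by fastforce
        then have "card ?L \<le> card (V - insert x (insert y (nbrs F x)))"
          using V by (intro card_mono) auto
        moreover have "card (V - insert x (insert y (nbrs F x))) = card V - card (insert x (insert y (nbrs F x)))"
          using N x y finN by (intro card_Diff_subset) auto
        ultimately have "card ?L \<le> s" using 2 by (simp add: \<mu>_def)
        then obtain K where K: "?L \<subseteq> K" "K \<subseteq> V" "card K = s"
          using exists_subset_between[of ?L s V] V 2 by auto
        have cVK: "card (V - K) = \<mu>" using K V by (simp add: \<mu>_def card_Diff_subset finite_subset)
        have nohigh: "{w \<in> V - K. \<mu> < degree E w} = {}" using \<mu> by force
        have "\<exists>F'. F' \<subseteq> [V]\<^bsup>2\<^esup> \<and> degree F' = degree E \<and> (\<forall>e\<in>F'. \<not> e \<subseteq> K)"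
        proof (rule independent_realization_core[OF V K(2), of \<mu>])
          show "card K \<le> card (V - K)" using cVK K 2 by (simp add: \<mu>_def)
          show "card {w \<in> V - K. \<mu> < degree E w} \<le> degree E u" for u
            by (simp only: nohigh card.empty le0)
          show "\<mu> \<le> degree E w" if "w \<in> V - K" for w using that K by force
          show "degree E w \<le> card K" if "w \<in> V - K" "\<mu> < degree E w" for w
            using that nohigh by blast
        qed (use \<mu> K cVK in auto)
        then show ?thesis using K by blast
      qed
    qed
  next
    case 3
    have "V \<noteq> {}" using 3 by auto
    \<comment> \<open>Now the induction only yields size \<open>s - 1\<close> after a deletion, so
      the deleted vertex has to join the set; one of least degree is taken.\<close>
    then obtain v where v: "v \<in> V" "\<And>w. w \<in> V \<Longrightarrow> degree E v \<le> degree E w"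
      using ex_has_least_nat[of "\<lambda>v. v \<in> V" _ "degree E"] by blast
    obtain F where F: "F \<subseteq> [V]\<^bsup>2\<^esup>" "degree F = degree E"
      and top: "\<And>z y. z \<in> nbrs F v \<Longrightarrow> y \<in> V \<Longrightarrow> y \<notin> nbrs F v \<Longrightarrow> y \<noteq> v \<Longrightarrow> degree E y \<le> degree E z"
      using top_nbrs_realization[OF V, of v] by blast
    let ?N = "nbrs F v" and ?F = "{e \<in> F. v \<notin> e}"
    have N: "?N \<subseteq> V - {v}" by (rule nbrs_subset[OF F(1)])
    have finN: "finite ?N" by (rule finite_nbrs[OF V(1) F(1)])
    have cardN: "card ?N = degree E v" using F(2) degree_eq_card_nbrs[OF F(1), of v] by simp
    have degF: "degree E w = degree ?F w + of_bool (w \<in> ?N)" if "w \<noteq> v" for w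
      using degree_delete_vertex[OF V(1) F(1), of w v] that F(2) by simp
    have "\<exists>F' I. F' \<subseteq> [V - {v}]\<^bsup>2\<^esup> \<and> degree F' = degree ?F \<and> I \<subseteq> V - {v} \<and> card I = s - 1
      \<and> (\<forall>e\<in>F'. \<not> e \<subseteq> I)"
    proof (rule delete[OF v(1) F(1)])
      fix w assume w: "w \<in> V - {v}"
      show "degree ?F w + (s - 1) \<le> card V - 1"
        using less(5)[of w] degF[of w] w 3 by simp
    qed (use 3 in simp)
    then obtain F1 I where F1: "F1 \<subseteq> [V - {v}]\<^bsup>2\<^esup>" "degree F1 = degree ?F"
      and I: "I \<subseteq> V - {v}" "card I = s - 1" "\<forall>e\<in>F1. \<not> e \<subseteq> I"
      by (elim exE conjE)
    \<comment> \<open>To admit \<open>v\<close>, the set of size \<open>s - 1\<close> is moved off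
      its neighbourhood. The strict inequality absorbs the degree that each neighbour of
      \<open>v\<close> loses by the deletion.\<close>
    have exch: ?thesis
      if Z: "Z \<subseteq> V - {v} - ?N" "s - 1 \<le> card Z" "\<And>z n. z \<in> Z \<Longrightarrow> n \<in> ?N \<Longrightarrow> degree E z < degree E n" for Z
    proof -
      have mono: "degree F1 z \<le> degree F1 n" if zn: "z \<in> Z" "n \<in> ?N" for z n
      proof -
        have "z \<noteq> v" "n \<noteq> v" using zn Z(1) N by auto
        then show ?thesis using degF[of z] degF[of n] zn Z(1) Z(3)[OF zn] F1(2) by auto
      qed
      have I': "card I \<le> card Z" "\<And>e. e \<in> F1 \<Longrightarrow> \<not> e \<subseteq> I" using I Z(2) by auto
      have "\<exists>F2 J. F2 \<subseteq> [V - {v}]\<^bsup>2\<^esup> \<and> degree F2 = degree F1 \<and> J \<subseteq> V - {v} - ?N \<and> card J = card I \<and>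
        (\<forall>e\<in>F2. \<not> e \<subseteq> J)"
        by (rule independent_set_avoiding[OF _ F1(1) I(1) I'(2) Z(1) I'(1) mono]) (use V in simp_all)
      then obtain F2 J where F2: "F2 \<subseteq> [V - {v}]\<^bsup>2\<^esup>" "degree F2 = degree F1"
        and J: "J \<subseteq> V - {v} - ?N" "card J = card I" "\<forall>e\<in>F2. \<not> e \<subseteq> J"
        by (elim exE conjE)
      note F3 = readd_vertex[OF V(1) F(1) F2(1) F2(2)[unfolded F1(2)]]
      have "finite J" using J V finite_subset by (metis finite_Diff)
      moreover have "v \<notin> J" using J by blast
      ultimately have "card (insert v J) = s" using J I 3 by simp
      moreover have "insert v J \<subseteq> V" using J v by blast
      moreover have "\<not> e \<subseteq> insert v J" if e: "e \<in> F2 \<union> {e \<in> F. v \<in> e}" for e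
      proof
        assume sub: "e \<subseteq> insert v J"
        show False
        proof (cases "e \<in> F2")
          case True
          then have "v \<notin> e" using F2 by (auto simp: nsets_def)
          then show False using sub J(3) True by blast
        next
          case False
          then have ev: "e \<in> F" "v \<in> e" using e by auto
          then obtain x y where "e = {x, y}" "x \<noteq> y" using F(1) nsets2_cases by blast
          then obtain w where "e = {v, w}" "w \<noteq> v" using ev by (metis insertE insert_commute singletonD)
          then have "w \<in> ?N" "w \<in> J" using ev sub by (auto simp: nbrs_def)
          then show False using J by blast
        qed
      qed
      ultimately show ?thesis using F3 F(2)
        by (intro exI[of _ "F2 \<union> {e \<in> F. v \<in> e}"] exI[of _ "insert v J"]) auto
    qed
    show ?thesis
    proof (cases "?N = {}")
      case True
      show ?thesis by (rule exch[of "V - {v}"]) (use True V v 3 in auto)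
    next
      case False
      then obtain n where n: "n \<in> ?N" "\<And>w. w \<in> ?N \<Longrightarrow> degree E n \<le> degree E w"
        using ex_has_least_nat[of "\<lambda>v. v \<in> ?N" _ "degree E"] by blast
      \<comment> \<open>Either enough non-neighbours of \<open>v\<close> have degree below
        \<open>g\<close> for the exchange, or few vertices lie below \<open>g\<close> and the core
        lemma applies with this threshold.\<close>
      define g where "g = degree E n"
      define Z where "Z = {z \<in> V - {v} - ?N. degree E z < g}"
      show ?thesis
      proof (cases "s - 1 \<le> card Z")
        case True
        show ?thesis by (rule exch[of Z]) (use True n in \<open>auto simp: Z_def g_def intro: less_le_trans\<close>)
      next
        case False
        let ?L = "{u \<in> V. degree E u < g}" and ?H = "{w \<in> V. g < degree E w}"
        have "?L \<subseteq> insert v Z" using n unfolding Z_def g_def by fastforce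
        then have "card ?L \<le> card (insert v Z)" using V by (intro card_mono) (auto simp: Z_def)
        also have "\<dots> \<le> s" using False V by (simp add: Z_def card_insert_if)
        finally have L: "card ?L \<le> s" .
        \<comment> \<open>A non-neighbour above \<open>g\<close> would outrank \<open>n\<close>,
          against the choice of \<open>F\<close>. So fewer than \<open>degree E v\<close> vertices
          exceed \<open>g\<close>, and \<open>v\<close> has least degree, as the core lemma
          requires.\<close>
        have "?H \<subseteq> ?N - {n}" using n top v(2)[of n] N unfolding g_def by fastforce
        then have "card ?H \<le> card (?N - {n})" using finN by (intro card_mono) auto
        then have H: "card ?H < degree E v" using cardN n finN card_Diff1_less[of ?N n] by simp
        have "V - ?H = {u \<in> V. degree E u \<le> g}" by auto
        moreover have "card (V - ?H) = card V - card ?H" using V by (intro card_Diff_subset) auto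
        ultimately have "s \<le> card {u \<in> V. degree E u \<le> g}"
          using H less(5)[OF v(1)] 3 by simp
        then have "\<exists>K. ?L \<subseteq> K \<and> K \<subseteq> {u \<in> V. degree E u \<le> g} \<and> card K = s"
          using V L by (intro exists_subset_between) auto
        then obtain K where K: "?L \<subseteq> K" "K \<subseteq> {u \<in> V. degree E u \<le> g}" "card K = s" by blast
        then have KV: "K \<subseteq> V" by blast
        have cVK: "card (V - K) = s" using K KV V 3 by (simp add: card_Diff_subset finite_subset)
        have "\<exists>F'. F' \<subseteq> [V]\<^bsup>2\<^esup> \<and> degree F' = degree E \<and> (\<forall>e\<in>F'. \<not> e \<subseteq> K)"
        proof (rule independent_realization_core[OF V KV, of g])
          show "card K \<le> card (V - K)" using cVK K by simp
          show "degree E u \<le> g" if "u \<in> K" for u using that K by blast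
          show "degree E u \<le> card (V - K)" if "u \<in> K" for u using that KV less(5)[of u] 3 cVK by force
          show "card {w \<in> V - K. g < degree E w} \<le> degree E u" if "u \<in> K" for u
          proof -
            have "card {w \<in> V - K. g < degree E w} \<le> card ?H" using V by (intro card_mono) auto
            also have "\<dots> \<le> degree E u" using H v(2)[of u] that KV by force
            finally show ?thesis .
          qed
          show "g \<le> degree E w" if "w \<in> V - K" for w using that K by force
          show "degree E w \<le> card K" if "w \<in> V - K" "g < degree E w" for w
            using that less(5)[of w] 3 K by force
        qed
        then show ?thesis using KV K by blast
      qed
    qed
  qed
qed

subsection \<open>Vertex-critical graphs\<close>

text \<open>A proper colouring given by its nonempty classes, so that \<open>card P\<close> counts
  the colours used and classes can be merged or compared between colourings.\<close>

definition indep_partition :: "'a set set \<Rightarrow> 'a set \<Rightarrow> 'a set set \<Rightarrow> bool" where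
  "indep_partition E S P \<longleftrightarrow>
     \<Union>P = S \<and> (\<forall>p\<in>P. \<forall>q\<in>P. p \<noteq> q \<longrightarrow> p \<inter> q = {}) \<and> {} \<notin> P \<and> (\<forall>p\<in>P. \<forall>e\<in>E. \<not> e \<subseteq> p)"

text \<open>For nonempty \<open>S\<close>, \<open>k\<close> is the chromatic number.
  Vertex-criticality appears in the form in which it is applied: \<open>S - {y}\<close> needs only
  \<open>k - 1\<close> classes, and \<open>{y}\<close> is added as one more.\<close>

locale critical_graph =
  fixes S :: "'a set" and E :: "'a set set" and k :: nat
  assumes fin: "finite S" and edges: "E \<subseteq> [S]\<^bsup>2\<^esup>"
    and lower: "indep_partition E S P \<Longrightarrow> k \<le> card P"
    and crit: "y \<in> S \<Longrightarrow> \<exists>P. indep_partition E S P \<and> card P = k \<and> {y} \<in> P"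
begin

definition optimal :: "'a set set \<Rightarrow> bool" where
  "optimal P \<longleftrightarrow> indep_partition E S P \<and> card P = k"

definition sing :: "'a set set \<Rightarrow> 'a set" where
  "sing P = {x. {x} \<in> P}"

definition tight :: "'a set set \<Rightarrow> bool" where
  "tight P \<longleftrightarrow> optimal P \<and> (\<forall>Q. optimal Q \<longrightarrow> card (sing P) \<le> card (sing Q))"

definition nonadj :: "('a \<times> 'a) set" where
  "nonadj = {(x, y). x \<in> S \<and> y \<in> S \<and> x \<noteq> y \<and> {x, y} \<notin> E}"

text \<open>For \<open>x\<close> in \<open>S\<close>, the component of \<open>x\<close> in the
  complement graph.\<close>

definition cocomp :: "'a \<Rightarrow> 'a set" where
  "cocomp x = nonadj\<^sup>* `` {x}"

lemma optimalD:
  assumes "optimal P"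
  shows "\<Union>P = S" "\<And>p q. p \<in> P \<Longrightarrow> q \<in> P \<Longrightarrow> p \<noteq> q \<Longrightarrow> p \<inter> q = {}" "{} \<notin> P"
    "\<And>p e. p \<in> P \<Longrightarrow> e \<in> E \<Longrightarrow> \<not> e \<subseteq> p" "card P = k" "finite P" "finite (sing P)" "sing P \<subseteq> S"
proof -
  have P: "indep_partition E S P" "card P = k" using assms by (auto simp: optimal_def)
  show U: "\<Union>P = S" and "\<And>p q. p \<in> P \<Longrightarrow> q \<in> P \<Longrightarrow> p \<noteq> q \<Longrightarrow> p \<inter> q = {}" and "{} \<notin> P"
    and "\<And>p e. p \<in> P \<Longrightarrow> e \<in> E \<Longrightarrow> \<not> e \<subseteq> p"
    using P(1) by (simp_all add: indep_partition_def)
  show "card P = k" by (rule P)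
  show "finite P" using U fin by (metis finite_UnionD)
  show "sing P \<subseteq> S" using U unfolding sing_def by blast
  then show "finite (sing P)" using fin finite_subset by blast
qed

text \<open>Two classes without an edge between them could be merged, leaving fewer than
  \<open>k\<close> classes.\<close>

lemma optimal_merge:
  assumes P: "optimal P" and pq: "p \<in> P" "q \<in> P" "p \<noteq> q"
  obtains x y where "x \<in> p" "y \<in> q" "{x, y} \<in> E"
proof (rule ccontr)
  assume "\<not> thesis"
  then have no: "\<And>x y. x \<in> p \<Longrightarrow> y \<in> q \<Longrightarrow> {x, y} \<notin> E" using that by blast
  note D = optimalD[OF P]
  have indep: "\<not> e \<subseteq> p \<union> q" if e: "e \<in> E" for e
  proof
    assume sub: "e \<subseteq> p \<union> q"
    obtain x y where xy: "e = {x, y}" using e edges nsets2_cases by blast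
    have "{y, x} \<in> E" using xy e by (simp add: insert_commute)
    then show False using sub xy e no[of x y] no[of y x] D(4)[OF pq(1) e] D(4)[OF pq(2) e] by blast
  qed
  have "indep_partition E S (insert (p \<union> q) (P - {p, q}))"
    unfolding indep_partition_def
  proof (intro conjI)
    show "\<Union>(insert (p \<union> q) (P - {p, q})) = S" using D(1) pq by blast
    show "\<forall>a\<in>insert (p \<union> q) (P - {p, q}). \<forall>b\<in>insert (p \<union> q) (P - {p, q}). a \<noteq> b \<longrightarrow> a \<inter> b = {}"
    proof (intro ballI impI)
      fix a b assume ab: "a \<in> insert (p \<union> q) (P - {p, q})" "b \<in> insert (p \<union> q) (P - {p, q})" "a \<noteq> b"
      have *: "c \<inter> (p \<union> q) = {}" if "c \<in> P - {p, q}" for c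
        using that D(2)[of c p] D(2)[of c q] pq by blast
      show "a \<inter> b = {}" using ab *[of a] *[of b] D(2)[of a b] by blast
    qed
    show "{} \<notin> insert (p \<union> q) (P - {p, q})" using D(3) pq by auto
    show "\<forall>a\<in>insert (p \<union> q) (P - {p, q}). \<forall>e\<in>E. \<not> e \<subseteq> a" using indep D(4) by blast
  qed
  then have "k \<le> card (insert (p \<union> q) (P - {p, q}))" by (rule lower)
  also have "\<dots> \<le> Suc (card (P - {p, q}))" by (rule card_insert_le_m1) auto
  also have "\<dots> < card P"
  proof -
    have "card (P - {p, q}) = card P - 2" using D(6) pq by (subst card_Diff_subset) auto
    moreover have "card {p, q} \<le> card P" using D(6) pq by (intro card_mono) auto
    ultimately show ?thesis using pq by auto
  qed
  finally show False using D(5) by simp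
qed

lemma sing_adjacent:
  assumes "optimal P" "x \<in> sing P" "y \<in> sing P" "x \<noteq> y"
  shows "{x, y} \<in> E"
  using optimal_merge[OF assms(1), of "{x}" "{y}"] assms(2-) by (auto simp: sing_def)

text \<open>Adding \<open>W\<close> and cutting it out of the other classes does not increase their
  number, because the remainder of \<open>{w}\<close> is empty and discarded; \<open>lower\<close>
  excludes a decrease.\<close>

lemma optimal_absorb:
  assumes Q: "optimal Q" and W: "W \<subseteq> S" "\<And>e. e \<in> E \<Longrightarrow> \<not> e \<subseteq> W" and w: "{w} \<in> Q" "w \<in> W"
  shows "optimal (insert W ((\<lambda>q. q - W) ` Q - {{}}))"
proof -
  let ?Q = "insert W ((\<lambda>q. q - W) ` Q - {{}})"
  note D = optimalD[OF Q]
  have part: "indep_partition E S ?Q"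
    unfolding indep_partition_def
  proof (intro conjI)
    show "\<Union>?Q = S"
    proof (intro equalityI subsetI)
      fix x assume x: "x \<in> S"
      then obtain q where "q \<in> Q" "x \<in> q" using D(1) by blast
      then show "x \<in> \<Union>?Q" by (cases "x \<in> W") auto
    qed (use D(1) W in auto)
    have *: "(q - W) \<inter> (q' - W) = {}" if "q \<in> Q" "q' \<in> Q" "q - W \<noteq> q' - W" for q q'
      using that D(2)[of q q'] by blast
    show "\<forall>a\<in>?Q. \<forall>b\<in>?Q. a \<noteq> b \<longrightarrow> a \<inter> b = {}"
    proof (intro ballI impI)
      fix a b assume ab: "a \<in> ?Q" "b \<in> ?Q" "a \<noteq> b"
      have Q: "c = W \<or> (\<exists>q\<in>Q. c = q - W)" if "c \<in> ?Q" for c using that by blast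
      show "a \<inter> b = {}" using Q[OF ab(1)] Q[OF ab(2)] ab(3) * by (elim disjE bexE) blast+
    qed
    show "{} \<notin> ?Q" using w by blast
    have "\<not> e \<subseteq> q - W" if "e \<in> E" "q \<in> Q" for e q using D(4)[OF that(2,1)] by blast
    then show "\<forall>a\<in>?Q. \<forall>e\<in>E. \<not> e \<subseteq> a" using W(2) by auto
  qed
  have "?Q \<subseteq> insert W ((\<lambda>q. q - W) ` (Q - {{w}}))" using w by auto
  then have "card ?Q \<le> card (insert W ((\<lambda>q. q - W) ` (Q - {{w}})))" using D(6) by (intro card_mono) auto
  also have "\<dots> \<le> Suc (card ((\<lambda>q. q - W) ` (Q - {{w}})))" by (rule card_insert_le_m1) auto
  also have "\<dots> \<le> Suc (card (Q - {{w}}))" using D(6) by (simp add: card_image_le)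
  also have "\<dots> = k" using D(5,6) w by (metis card_Suc_Diff1)
  finally show ?thesis using part lower[OF part] by (simp add: optimal_def)
qed

text \<open>
  Among the optimal partitions with the class \<open>{y}\<close>, one that shares as many classes as possible with
  \<open>P\<close> has no singleton class besides \<open>{y}\<close> and those of \<open>P\<close>.
\<close>

lemma tight_exchange:
  assumes P: "tight P" and x: "x \<in> sing P" and y: "(x, y) \<in> nonadj"
  obtains Q where "tight Q" "sing Q = insert y (sing P - {x})"
proof -
  have oP: "optimal P" using P by (simp add: tight_def)
  note D = optimalD[OF oP]
  have yS: "y \<in> S" "x \<noteq> y" "{x, y} \<notin> E" using y by (auto simp: nonadj_def)
  let ?R = "\<lambda>Q. optimal Q \<and> {y} \<in> Q"
  obtain Q0 where "?R Q0" using crit[OF yS(1)] by (auto simp: optimal_def)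
  moreover have "\<forall>Q. ?R Q \<longrightarrow> card (P \<inter> Q) < Suc (card P)"
    using D(6) by (auto simp: less_Suc_eq_le intro!: card_mono)
  ultimately have "\<exists>Q. ?R Q \<and> (\<forall>Q'. ?R Q' \<longrightarrow> card (P \<inter> Q') \<le> card (P \<inter> Q))"
    by (rule ex_has_greatest_nat)
  then obtain Q where Q: "optimal Q" "{y} \<in> Q" and max: "\<And>Q'. optimal Q' \<Longrightarrow> {y} \<in> Q' \<Longrightarrow> card (P \<inter> Q') \<le> card (P \<inter> Q)"
    by blast
  note DQ = optimalD[OF Q(1)]
  \<comment> \<open>Let \<open>{w}\<close> be a new singleton class and \<open>W\<close> the class
    of \<open>w\<close> in \<open>P\<close>. Singleton classes of \<open>Q\<close> are adjacent, so
    \<open>W\<close> omits \<open>y\<close>. If \<open>W\<close> absorbs \<open>{w}\<close>, then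
    \<open>{y}\<close> and all classes shared with \<open>P\<close> survive and \<open>W\<close>
    becomes shared too, against the maximality of \<open>Q\<close>.\<close>
  have "sing Q \<subseteq> insert y (sing P)"
  proof (rule ccontr)
    assume "\<not> ?thesis"
    then obtain w where w: "{w} \<in> Q" "w \<noteq> y" "{w} \<notin> P" by (auto simp: sing_def)
    then have "w \<in> S" using DQ(1) by blast
    then obtain W where W: "W \<in> P" "w \<in> W" using D(1) by blast
    have yW: "y \<notin> W"
    proof
      assume "y \<in> W"
      have "{w, y} \<in> E" using sing_adjacent[OF Q(1), of w y] w Q(2) by (simp add: sing_def)
      then show False using D(4)[OF W(1)] W(2) \<open>y \<in> W\<close> by blast
    qed
    let ?Q = "insert W ((\<lambda>q. q - W) ` Q - {{}})"
    have oQ: "optimal ?Q"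
      using optimal_absorb[OF Q(1), of W w] W w D(1,4) by blast
    have "{y} - W = {y}" using yW by blast
    then have yQ: "{y} \<in> ?Q" using imageI[OF Q(2), of "\<lambda>q. q - W"] by simp
    have WQ: "W \<notin> Q" using DQ(2)[OF w(1), of W] W w by blast
    have "P \<inter> Q \<subseteq> P \<inter> ?Q"
    proof
      fix C assume C: "C \<in> P \<inter> Q"
      then have "C \<noteq> W" using WQ by blast
      then have "C - W = C" using D(2)[of C W] C W by blast
      moreover have "C \<noteq> {}" using D(3) C by blast
      ultimately show "C \<in> P \<inter> ?Q" using C imageI[of C Q "\<lambda>q. q - W"] by simp
    qed
    then have "insert W (P \<inter> Q) \<subseteq> P \<inter> ?Q" using W by blast
    then have "card (insert W (P \<inter> Q)) \<le> card (P \<inter> ?Q)" using D(6) by (intro card_mono) auto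
    then show False using max[OF oQ yQ] WQ D(6) by simp
  qed
  moreover have "x \<notin> sing Q"
    using sing_adjacent[OF Q(1), of x y] Q(2) yS by (auto simp: sing_def)
  ultimately have sub: "sing Q \<subseteq> insert y (sing P - {x})" by blast
  \<comment> \<open>By tightness of \<open>P\<close>, \<open>Q\<close> has at least as many
    singleton classes as \<open>P\<close>, so the inclusion \<open>sub\<close> is an
    equality.\<close>
  have "card (insert y (sing P - {x})) \<le> Suc (card (sing P - {x}))" using D(7) by (simp add: card_insert_if)
  also have "\<dots> = card (sing P)" using x D(7) by (simp add: card_Suc_Diff1 del: card_Diff_insert)
  finally have le: "card (insert y (sing P - {x})) \<le> card (sing P)" .
  also have "\<dots> \<le> card (sing Q)" using P Q(1) by (simp add: tight_def)
  finally have eq: "sing Q = insert y (sing P - {x})"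
    using sub D(7) by (intro card_seteq) auto
  have "card (sing Q) \<le> card (sing P)"
    using le eq by simp
  then have "tight Q" using P Q(1) unfolding tight_def by (meson order_trans)
  with eq that show thesis by blast
qed

text \<open>Gallai's argument along a path in the complement: exchanging \<open>x\<close> for the
  next vertex \<open>y\<close> keeps the partition tight and \<open>{z}\<close> a class, so
  \<open>y = z\<close> by induction. But then \<open>x\<close> and \<open>z\<close> are nonadjacent,
  while singleton classes of \<open>P\<close> are adjacent.\<close>

lemma tight_sing_cocomp:
  assumes "tight P" "x \<in> sing P" "z \<in> sing P" "(x, z) \<in> nonadj\<^sup>*"
  shows "x = z"
  using assms(4) assms(1-3)
proof (induction arbitrary: P rule: converse_rtrancl_induct)
  case (step x y)
  show ?case
  proof (rule ccontr)
    assume "x \<noteq> z"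
    obtain Q where Q: "tight Q" "sing Q = insert y (sing P - {x})"
      using tight_exchange[OF step(4,5,1)] .
    then have "y = z" using step(3)[of Q] step(6) \<open>x \<noteq> z\<close> by auto
    moreover have "{x, z} \<in> E" using sing_adjacent[of P x z] step(4-6) \<open>x \<noteq> z\<close> by (simp add: tight_def)
    ultimately show False using step(1) by (simp add: nonadj_def)
  qed
qed simp

section \<open>Components of the complement\<close>

lemma sym_nonadj: "sym nonadj"
  unfolding sym_def nonadj_def by (auto simp: insert_commute)

lemma cocomp_eq: "y \<in> cocomp x \<Longrightarrow> cocomp y = cocomp x"
proof -
  assume "y \<in> cocomp x"
  then have "(x, y) \<in> nonadj\<^sup>*" "(y, x) \<in> nonadj\<^sup>*"
    using sym_rtrancl[OF sym_nonadj] by (auto simp: cocomp_def dest: symD)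
  then show ?thesis unfolding cocomp_def by (auto intro: rtrancl_trans)
qed

lemma self_in_cocomp: "x \<in> cocomp x"
  by (simp add: cocomp_def)

lemma cocomp_subset: "x \<in> S \<Longrightarrow> cocomp x \<subseteq> S"
proof
  fix y assume "x \<in> S" "y \<in> cocomp x"
  then have "(x, y) \<in> nonadj\<^sup>*" by (simp add: cocomp_def)
  then show "y \<in> S" using \<open>x \<in> S\<close> by induction (auto simp: nonadj_def)
qed

lemma adjacent_outside_cocomp:
  assumes "x \<in> S" "y \<in> S" "y \<notin> cocomp x"
  shows "{x, y} \<in> E"
proof (rule ccontr)
  assume "{x, y} \<notin> E"
  then have "(x, y) \<in> nonadj" using assms self_in_cocomp[of x] by (auto simp: nonadj_def)
  then show False using assms by (auto simp: cocomp_def)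
qed

text \<open>The vertices of a class are pairwise adjacent in the complement.\<close>

lemma class_in_cocomp:
  assumes "optimal P" "p \<in> P" "x \<in> p" "x \<in> cocomp t"
  shows "p \<subseteq> cocomp t"
proof
  fix y assume y: "y \<in> p"
  note D = optimalD[OF assms(1)]
  have "x \<in> S" "y \<in> S" using D(1) assms y by auto
  moreover have "{x, y} \<notin> E" using D(4)[OF assms(2)] assms(3) y by blast
  ultimately have "y \<in> cocomp x" using adjacent_outside_cocomp by blast
  then show "y \<in> cocomp t" using cocomp_eq[OF assms(4)] by simp
qed

lemma Union_classes_in_cocomp:
  assumes "optimal P" "t \<in> S"
  shows "\<Union>{p \<in> P. p \<subseteq> cocomp t} = cocomp t"
proof (intro equalityI subsetI)
  fix x assume x: "x \<in> cocomp t"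
  then have "x \<in> S" using cocomp_subset[OF assms(2)] by blast
  then obtain p where p: "p \<in> P" "x \<in> p" using optimalD(1)[OF assms(1)] by blast
  then show "x \<in> \<Union>{p \<in> P. p \<subseteq> cocomp t}" using class_in_cocomp[OF assms(1) p x] by blast
qed blast

text \<open>Replacing the classes of \<open>Q\<close> inside the co-component by those of
  \<open>P\<close> gives a partition again, which cannot have fewer than \<open>k\<close> classes.
  By symmetry all optimal partitions have equally many classes there.\<close>

lemma card_classes_in_cocomp_le:
  assumes P: "optimal P" and Q: "optimal Q"
  shows "card {q \<in> Q. q \<subseteq> cocomp t} \<le> card {p \<in> P. p \<subseteq> cocomp t}"
proof -
  note D = optimalD[OF P] and DQ = optimalD[OF Q]
  let ?A = "{p \<in> P. p \<subseteq> cocomp t}" and ?B = "{q \<in> Q. \<not> q \<subseteq> cocomp t}"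
  have split: "q \<inter> cocomp t = {}" if "q \<in> ?B" for q
    using that class_in_cocomp[OF Q, of q _ t] by blast
  have "indep_partition E S (?A \<union> ?B)"
    unfolding indep_partition_def
  proof (intro conjI)
    show "\<Union>(?A \<union> ?B) = S"
    proof (intro equalityI subsetI)
      fix x assume x: "x \<in> S"
      obtain p where p: "p \<in> P" "x \<in> p" using D(1) x by blast
      obtain q where q: "q \<in> Q" "x \<in> q" using DQ(1) x by blast
      show "x \<in> \<Union>(?A \<union> ?B)" using p q class_in_cocomp[OF P p, of t] by blast
    qed (use D(1) DQ(1) in blast)
    show "\<forall>a\<in>?A \<union> ?B. \<forall>b\<in>?A \<union> ?B. a \<noteq> b \<longrightarrow> a \<inter> b = {}"
      using D(2) DQ(2) split by blast
    show "{} \<notin> ?A \<union> ?B" using D(3) DQ(3) by blast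
    show "\<forall>a\<in>?A \<union> ?B. \<forall>e\<in>E. \<not> e \<subseteq> a" using D(4) DQ(4) by blast
  qed
  then have "card Q \<le> card (?A \<union> ?B)" using lower DQ(5) by blast
  also have "\<dots> \<le> card ?A + card ?B" by (rule card_Un_le)
  also have "card Q = card {q \<in> Q. q \<subseteq> cocomp t} + card ?B"
    using DQ(6) by (subst card_Un_disjoint[symmetric]) (auto intro: arg_cong[where f = card])
  finally show ?thesis by simp
qed

text \<open>Otherwise the only classes there are \<open>{t}\<close> and the class \<open>q\<close>
  of a non-neighbour \<open>y\<close> of \<open>t\<close>. An optimal partition with class
  \<open>{y}\<close> also has at most two classes there, so \<open>t\<close> shares a class with the
  rest of \<open>q\<close>. Thus \<open>t\<close> has no neighbour in \<open>q\<close>, against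
  \<open>optimal_merge\<close>.\<close>

lemma three_classes_in_cocomp:
  assumes P: "optimal P" and t: "{t} \<in> P" and C: "cocomp t \<noteq> {t}"
  shows "3 \<le> card {p \<in> P. p \<subseteq> cocomp t}"
proof (rule ccontr)
  let ?A = "{p \<in> P. p \<subseteq> cocomp t}"
  assume "\<not> 3 \<le> card ?A"
  then have le2: "card ?A \<le> 2" by simp
  note D = optimalD[OF P]
  have tS: "t \<in> S" using D(1) t by blast
  have two: "a = b" if "finite X" "card X \<le> 2" "c \<in> X" "a \<in> X" "b \<in> X" "a \<noteq> c" "b \<noteq> c" for X :: "'a set set" and a b c
  proof (rule ccontr)
    assume "a \<noteq> b"
    then have "card {a, b, c} = 3" using that by auto
    moreover have "card {a, b, c} \<le> card X" using that by (intro card_mono) auto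
    ultimately show False using that by simp
  qed
  obtain z where "(t, z) \<in> nonadj\<^sup>*" "z \<noteq> t" using C self_in_cocomp[of t] by (auto simp: cocomp_def)
  then obtain y where y: "(t, y) \<in> nonadj" by (metis converse_rtranclE)
  then have yS: "y \<in> S" "y \<noteq> t" "{t, y} \<notin> E" by (auto simp: nonadj_def)
  have yC: "y \<in> cocomp t" using y by (auto simp: cocomp_def)
  obtain q where q: "q \<in> P" "y \<in> q" using D(1) yS by blast
  have qA: "q \<in> ?A" "{t} \<in> ?A" "q \<noteq> {t}"
    using q class_in_cocomp[OF P q yC] t self_in_cocomp[of t] yS by auto
  obtain Q where Q: "optimal Q" "{y} \<in> Q" using crit[OF yS(1)] by (auto simp: optimal_def)
  note DQ = optimalD[OF Q(1)]
  let ?B = "{p \<in> Q. p \<subseteq> cocomp t}"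
  have B2: "card ?B \<le> 2" using card_classes_in_cocomp_le[OF P Q(1), of t] le2 by linarith
  obtain b where b: "b \<in> ?B" "t \<in> b"
    using Union_classes_in_cocomp[OF Q(1) tS] self_in_cocomp[of t] by blast
  have "{t, x} \<notin> E" if x: "x \<in> q" for x
  proof (cases "x = y")
    case False
    have "x \<in> cocomp t" using x qA by blast
    then obtain a where a: "a \<in> ?B" "x \<in> a"
      using Union_classes_in_cocomp[OF Q(1) tS] by blast
    have "a = b"
      by (rule two[of ?B "{y}"]) (use DQ(6) B2 Q(2) yC a b False yS in auto)
    then show ?thesis using DQ(4)[of a "{t, x}"] a b by blast
  qed (use yS in simp)
  moreover obtain w x where "w \<in> {t}" "x \<in> q" "{w, x} \<in> E"
    by (rule optimal_merge[OF P t q(1)]) (use qA in auto)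
  ultimately show False by auto
qed

section \<open>Counting classes and neighbours\<close>

lemma two_card_le_card_Union:
  assumes P: "optimal P" and P': "P' \<subseteq> P"
  shows "2 * card P' \<le> card (\<Union>P') + card {x. {x} \<in> P'}"
proof -
  note D = optimalD[OF P]
  have finP': "finite P'" using P' D(6) finite_subset by blast
  have finp: "finite p" if "p \<in> P'" for p
    using that P' D(1) fin by (metis Sup_upper finite_subset subsetD)
  have "{p \<in> P'. \<exists>x. p = {x}} = (\<lambda>x. {x}) ` {x. {x} \<in> P'}" by auto
  then have sing: "card {p \<in> P'. \<exists>x. p = {x}} = card {x. {x} \<in> P'}"
    by (simp add: card_image)
  have "card p + of_bool (\<exists>x. p = {x}) \<ge> 2" if "p \<in> P'" for p
  proof -
    have "card p \<noteq> 0" using that P' D(3) finp[OF that] by auto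
    moreover have "card p = 1 \<Longrightarrow> \<exists>x. p = {x}" by (simp add: card_1_singleton_iff)
    ultimately show ?thesis by (cases "card p = 1") auto
  qed
  then have "(\<Sum>p\<in>P'. 2) \<le> (\<Sum>p\<in>P'. card p + of_bool (\<exists>x. p = {x}))" by (intro sum_mono)
  also have "\<dots> = (\<Sum>p\<in>P'. card p) + card {p \<in> P'. \<exists>x. p = {x}}"
    using finP' by (simp add: sum.distrib of_bool_def sum.If_cases Int_def)
  also have "(\<Sum>p\<in>P'. card p) = card (\<Union>P')"
    using finp D(2) P' by (intro card_Union_disjoint[symmetric]) (auto simp: pairwise_def disjnt_def)
  finally show ?thesis using sing by simp
qed

text \<open>By \<open>optimal_merge\<close>, \<open>t\<close> has a neighbour in every other class,
  and these neighbours are distinct because classes are disjoint.\<close>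

lemma card_classes_le_nbrs:
  assumes P: "optimal P" and t: "{t} \<in> P" and P': "P' \<subseteq> P - {{t}}"
  shows "card P' \<le> card (nbrs E t \<inter> \<Union>P')"
proof -
  note D = optimalD[OF P]
  have finN: "finite (nbrs E t)" by (rule finite_nbrs[OF fin edges])
  have "\<forall>p\<in>P'. \<exists>x. x \<in> p \<and> x \<in> nbrs E t"
  proof
    fix p assume p: "p \<in> P'"
    obtain w x where "w \<in> {t}" "x \<in> p" "{w, x} \<in> E"
      by (rule optimal_merge[OF P t, of p]) (use p P' in auto)
    then show "\<exists>x. x \<in> p \<and> x \<in> nbrs E t" by (auto simp: nbrs_def)
  qed
  then obtain f where f: "\<And>p. p \<in> P' \<Longrightarrow> f p \<in> p \<and> f p \<in> nbrs E t"
    using bchoice[of P' "\<lambda>p x. x \<in> p \<and> x \<in> nbrs E t"] by blast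
  have "inj_on f P'"
  proof (rule inj_onI)
    fix p q assume pq: "p \<in> P'" "q \<in> P'" "f p = f q"
    then have "f p \<in> p \<inter> q" using f[of p] f[of q] by auto
    then show "p = q" using D(2)[of p q] pq P' by blast
  qed
  moreover have "f ` P' \<subseteq> nbrs E t \<inter> \<Union>P'" using f by blast
  ultimately show ?thesis using finN by (intro card_inj_on_le) auto
qed

lemma degree_ge:
  assumes "y \<in> S"
  shows "k \<le> degree E y + 1"
proof -
  obtain P where P: "optimal P" "{y} \<in> P" using crit[OF assms] by (auto simp: optimal_def)
  have "card (P - {{y}}) \<le> card (nbrs E y \<inter> \<Union>(P - {{y}}))"
    by (rule card_classes_le_nbrs[OF P]) simp
  also have "\<dots> \<le> degree E y"
    using finite_nbrs[OF fin edges] by (auto simp: degree_eq_card_nbrs[OF edges] intro: card_mono)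
  finally show ?thesis using optimalD(5,6)[OF P(1)] P(2) by simp
qed

text \<open>\<open>t\<close> is adjacent to everything outside its co-component and has a neighbour
  in each other class inside it.\<close>

lemma degree_sing_ge:
  assumes P: "optimal P" and t: "{t} \<in> P"
  shows "card S + card {p \<in> P. p \<subseteq> cocomp t} \<le> degree E t + card (cocomp t) + 1"
proof -
  note D = optimalD[OF P]
  let ?A = "{p \<in> P. p \<subseteq> cocomp t}"
  have tS: "t \<in> S" using D(1) t by blast
  have finN: "finite (nbrs E t)" by (rule finite_nbrs[OF fin edges])
  have "card (?A - {{t}}) \<le> card (nbrs E t \<inter> \<Union>(?A - {{t}}))"
    by (rule card_classes_le_nbrs[OF P t]) auto
  also have "\<dots> \<le> card (nbrs E t \<inter> cocomp t)" using finN by (intro card_mono) auto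
  finally have "card (?A - {{t}}) \<le> card (nbrs E t \<inter> cocomp t)" .
  moreover have "{t} \<in> ?A" using t self_in_cocomp[of t] by simp
  then have "card ?A = Suc (card (?A - {{t}}))" using D(6) by (simp add: card_Suc_Diff1 del: card_Diff_insert)
  moreover have "S - cocomp t \<subseteq> nbrs E t - cocomp t"
    using adjacent_outside_cocomp[OF tS] by (auto simp: nbrs_def)
  then have "card (S - cocomp t) \<le> card (nbrs E t - cocomp t)" using finN by (intro card_mono) auto
  moreover have "card (nbrs E t) = card (nbrs E t \<inter> cocomp t) + card (nbrs E t - cocomp t)"
    using finN by (subst card_Un_disjoint[symmetric]) (auto intro: arg_cong[where f = card])
  moreover have "card (S - cocomp t) = card S - card (cocomp t)"
    using cocomp_subset[OF tS] fin finite_subset by (intro card_Diff_subset) auto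
  moreover have "card (cocomp t) \<le> card S" using cocomp_subset[OF tS] fin by (intro card_mono)
  moreover have "degree E t = card (nbrs E t)" by (rule degree_eq_card_nbrs[OF edges])
  ultimately show ?thesis by linarith
qed

text \<open>\<open>A\<close> consists of the singleton classes of a tight partition that fill their
  co-component. The vertex \<open>v\<close> is taken from \<open>A\<close> if possible and otherwise
  from the remaining singleton classes; if there are none, the first alternative holds.\<close>

lemma universal_or_large_degree:
  assumes "S \<noteq> {}"
  obtains A where "A \<subseteq> S" "card A \<le> k" "\<And>a y. a \<in> A \<Longrightarrow> y \<in> S \<Longrightarrow> y \<noteq> a \<Longrightarrow> {a, y} \<in> E"
    "2 * k \<le> card S + card A \<or> (\<exists>v\<in>S. 5 * k \<le> 2 * card S + 2 * card A + degree E v + 3)"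
proof -
  obtain P0 where P0: "optimal P0" using assms crit by (auto simp: optimal_def)
  have "\<exists>P. optimal P \<and> (\<forall>Q. optimal Q \<longrightarrow> card (sing P) \<le> card (sing Q))"
    using ex_has_least_nat[of optimal P0 "\<lambda>P. card (sing P)"] P0 by blast
  then obtain P where tP: "tight P" unfolding tight_def by blast
  then have P: "optimal P" by (simp add: tight_def)
  note D = optimalD[OF P]
  define T where "T = sing P"
  have T: "t \<in> T \<longleftrightarrow> {t} \<in> P" for t by (simp add: T_def sing_def)
  have finT: "finite T" and TS: "T \<subseteq> S" using D(7,8) by (auto simp: T_def)
  define cl where "cl t = {p \<in> P. p \<subseteq> cocomp t}" for t
  have fincl: "finite (cl t)" for t using D(6) by (simp add: cl_def)
  have disj: "cl t \<inter> cl t' = {}" if t: "t \<in> T" "t' \<in> T" "t \<noteq> t'" for t t'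
  proof (rule ccontr)
    assume "cl t \<inter> cl t' \<noteq> {}"
    then obtain p where p: "p \<in> P" "p \<subseteq> cocomp t" "p \<subseteq> cocomp t'" by (auto simp: cl_def)
    have "p \<noteq> {}" using p(1) D(3) by blast
    then obtain x where "x \<in> cocomp t" "x \<in> cocomp t'" using p by blast
    then have "cocomp t = cocomp t'" using cocomp_eq by metis
    then have "t' \<in> cocomp t" using self_in_cocomp[of t'] by simp
    then have "(t, t') \<in> nonadj\<^sup>*" by (simp add: cocomp_def)
    then show False using tight_sing_cocomp[OF tP, of t t'] t by (simp add: T_def)
  qed
  have sum_cl: "(\<Sum>t\<in>U. card (cl t)) = card (\<Union>t\<in>U. cl t)" if "U \<subseteq> T" for U
  proof (rule card_UN_disjoint[symmetric])
    show "finite U" using that finT finite_subset by blast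
    show "\<forall>t\<in>U. \<forall>t'\<in>U. t \<noteq> t' \<longrightarrow> cl t \<inter> cl t' = {}" using that disj by (meson subsetD)
  qed (use fincl in simp)
  define A where "A = {t \<in> T. cocomp t = {t}}"
  define B where "B = T - A"
  have TAB: "card T = card A + card B" "A \<subseteq> T" "B \<subseteq> T" "finite A" "finite B" "A \<inter> B = {}" "A \<union> B = T"
  proof -
    show AB: "A \<subseteq> T" "B \<subseteq> T" "A \<inter> B = {}" "A \<union> B = T" by (auto simp: A_def B_def)
    show f: "finite A" "finite B" using finT AB finite_subset by blast+
    show "card T = card A + card B" using card_Un_disjoint[OF f AB(3)] AB(4) by simp
  qed
  have cl3: "3 \<le> card (cl t)" if "t \<in> B" for t
    using three_classes_in_cocomp[OF P, of t] that T by (auto simp: cl_def A_def B_def)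
  have cl1: "1 \<le> card (cl t)" if "t \<in> T" for t
  proof -
    have "{t} \<in> cl t" using that T self_in_cocomp[of t] by (simp add: cl_def)
    then show ?thesis using fincl[of t] by (metis One_nat_def Suc_leI card_gt_0_iff empty_iff)
  qed
  have kT: "card A + 3 * card B \<le> k"
  proof -
    have "card A + 3 * card B \<le> (\<Sum>t\<in>A. card (cl t)) + (\<Sum>t\<in>B. card (cl t))"
      using sum_bounded_below[of A 1 "\<lambda>t. card (cl t)"] sum_bounded_below[of B 3 "\<lambda>t. card (cl t)"] cl1 cl3 TAB
      by force
    also have "\<dots> = (\<Sum>t\<in>T. card (cl t))"
      using TAB sum.union_disjoint[of A B "\<lambda>t. card (cl t)"] by simp
    also have "\<dots> = card (\<Union>t\<in>T. cl t)" by (rule sum_cl) simp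
    also have "\<dots> \<le> card P" using D(6) by (intro card_mono) (auto simp: cl_def)
    finally show ?thesis using D(5) by simp
  qed
  have m: "2 * k \<le> card S + card T"
    using two_card_le_card_Union[OF P subset_refl] D(1,5) by (simp add: T_def sing_def)
  have univ: "{a, y} \<in> E" if "a \<in> A" "y \<in> S" "y \<noteq> a" for a y
    using adjacent_outside_cocomp[of a y] that TS by (auto simp: A_def)
  have deg: "card S + card (cl t) \<le> degree E t + card (cocomp t) + 1" if "t \<in> T" for t
    using degree_sing_ge[OF P, of t] that T by (simp add: cl_def)
  have "2 * k \<le> card S + card A \<or> (\<exists>v\<in>S. 5 * k \<le> 2 * card S + 2 * card A + degree E v + 3)"
  proof (cases "A = {}")
    case False
    then obtain t where t: "t \<in> A" by blast
    then have "card (cocomp t) = 1" "t \<in> T" by (auto simp: A_def)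
    then have "card S \<le> degree E t + 1" using deg[of t] cl1[of t] by simp
    moreover have "card A \<noteq> 0" using t TAB by auto
    \<comment> \<open>Three times \<open>m\<close> together with \<open>kT\<close> gives
      \<open>5 * k \<le> 3 * card S + 2 * card A\<close>, and one \<open>card S\<close> is at most
      \<open>degree E t + 1\<close>.\<close>
    ultimately have "5 * k \<le> 2 * card S + 2 * card A + degree E t + 3"
      using m kT TAB(1) by linarith
    then show ?thesis using t TAB TS by blast
  next
    case True
    show ?thesis
    proof (cases "T = {}")
      case True
      then show ?thesis using m by simp
    next
      case False
      then obtain t where t: "t \<in> T" by blast
      then have tS: "t \<in> S" using TS by blast
      have TB: "B = T" "card A = 0" using True TAB by auto
      have U: "\<Union>(cl t) = cocomp t" unfolding cl_def by (rule Union_classes_in_cocomp[OF P tS])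
      \<comment> \<open>With \<open>t\<close> as the only singleton class of its co-component, the
        classes are counted separately inside and outside of it.\<close>
      have "{x. {x} \<in> cl t} = {t}"
      proof (intro equalityI subsetI)
        fix x assume "x \<in> {x. {x} \<in> cl t}"
        then have "x \<in> sing P" "(t, x) \<in> nonadj\<^sup>*" by (auto simp: cl_def sing_def cocomp_def)
        then show "x \<in> {t}" using tight_sing_cocomp[OF tP, of t x] t by (simp add: T_def)
      qed (use t T self_in_cocomp[of t] in \<open>simp add: cl_def\<close>)
      then have in1: "2 * card (cl t) \<le> card (cocomp t) + 1"
        using two_card_le_card_Union[OF P, of "cl t"] U by (simp add: cl_def)
      have "\<Union>(P - cl t) \<subseteq> S - cocomp t"
        using class_in_cocomp[OF P, of _ _ t] D(1) unfolding cl_def by blast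
      then have "card (\<Union>(P - cl t)) \<le> card (S - cocomp t)" using fin by (intro card_mono) auto
      moreover have "card (S - cocomp t) = card S - card (cocomp t)"
        using cocomp_subset[OF tS] fin finite_subset by (intro card_Diff_subset) auto
      moreover have "{x. {x} \<in> P - cl t} \<subseteq> T - {t}"
        using T t self_in_cocomp by (auto simp: cl_def)
      then have "card {x. {x} \<in> P - cl t} \<le> card (T - {t})" using finT by (intro card_mono) auto
      moreover have "card (P - cl t) = k - card (cl t)"
        using D(5) fincl by (subst card_Diff_subset) (auto simp: cl_def)
      moreover have "2 * card (P - cl t) \<le> card (\<Union>(P - cl t)) + card {x. {x} \<in> P - cl t}"
        by (rule two_card_le_card_Union[OF P]) auto
      moreover have cT: "card (T - {t}) = card T - 1" "card T \<ge> 1"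
        using t finT card_gt_0_iff[of T] by (auto simp: Suc_le_eq)
      ultimately have out1: "2 * (k - card (cl t)) \<le> card S - card (cocomp t) + (card T - 1)" by linarith
      \<comment> \<open>Every other singleton class brings at least three classes of its own, all
        outside the co-component of \<open>t\<close>.\<close>
      have "3 * card (T - {t}) \<le> (\<Sum>t'\<in>T - {t}. card (cl t'))"
        using sum_bounded_below[of "T - {t}" 3 "\<lambda>t. card (cl t)"] cl3 TB by (simp add: mult.commute)
      also have "\<dots> = card (\<Union>t'\<in>T - {t}. cl t')" by (rule sum_cl) auto
      also have "\<dots> \<le> card (P - cl t)"
        using D(6) disj[OF t] by (intro card_mono) (auto simp: cl_def)
      finally have out2: "3 * (card T - 1) \<le> k - card (cl t)"
        using \<open>card (P - cl t) = k - card (cl t)\<close> cT by simp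
      have "card (cl t) \<le> k" using D(5,6) by (metis (no_types, lifting) card_mono cl_def mem_Collect_eq subsetI)
      moreover have "card (cocomp t) \<le> card S" using cocomp_subset[OF tS] fin by (intro card_mono)
      \<comment> \<open>Write \<open>c\<close> for \<open>card (cl t)\<close> and \<open>d\<close>
        for \<open>card (cocomp t)\<close>. Three times \<open>out1\<close> plus \<open>out2\<close>
        gives \<open>5 * (k - c) \<le> 3 * (card S - d)\<close>; adding twice \<open>in1\<close> and
        the degree bound for \<open>t\<close> gives the claim.\<close>
      ultimately have "5 * k \<le> 2 * card S + 2 * card A + degree E t + 3"
        using in1 out1 out2 deg[OF t] TB by linarith
      then show ?thesis using tS by blast
    qed
  qed
  moreover have "card A \<le> k" "A \<subseteq> S" using kT TAB TS by auto
  ultimately show thesis using that univ by blast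
qed

end

subsection \<open>Chromatic number and degree sequences\<close>

lemma chromatic_number_le_card_partition:
  assumes "finite P" "indep_partition E V P"
  shows "chromatic_number V E \<le> card P"
proof -
  obtain h where h: "bij_betw h P {0..<card P}" using ex_bij_betw_finite_nat[OF assms(1)] by blast
  have "\<forall>v\<in>V. \<exists>p. p \<in> P \<and> v \<in> p" using assms(2) by (auto simp: indep_partition_def)
  then obtain f where f: "\<And>v. v \<in> V \<Longrightarrow> f v \<in> P \<and> v \<in> f v"
    using bchoice[of V "\<lambda>v p. p \<in> P \<and> v \<in> p"] by blast
  have "proper_coloring V E (card P) (h \<circ> f)"
    unfolding proper_coloring_def
  proof (intro conjI ballI impI)
    show "(h \<circ> f) ` V \<subseteq> {..<card P}"
      using bij_betwE[OF h] f by fastforce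
    fix u v assume uv: "u \<in> V" "v \<in> V" "{u, v} \<in> E"
    show "(h \<circ> f) u \<noteq> (h \<circ> f) v"
    proof
      assume "(h \<circ> f) u = (h \<circ> f) v"
      then have "f u = f v" using inj_onD[OF bij_betw_imp_inj_on[OF h]] f uv by auto
      then have "{u, v} \<subseteq> f u" using f[OF uv(1)] f[OF uv(2)] by simp
      moreover have "\<forall>e\<in>E. \<not> e \<subseteq> f u" using assms(2) f[OF uv(1)] by (simp add: indep_partition_def)
      ultimately show False using uv(3) by blast
    qed
  qed
  then show ?thesis unfolding chromatic_number_def by (intro Least_le) blast
qed

text \<open>\<open>S\<close> is a smallest vertex set that needs as many classes as the whole graph.
  Without \<open>y\<close> fewer classes suffice, and restoring \<open>{y}\<close> gives exactly the
  chromatic number.\<close>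

lemma obtain_critical_graph:
  assumes V: "finite V" "E \<subseteq> [V]\<^bsup>2\<^esup>" and pos: "0 < chromatic_number V E"
  obtains S where "S \<subseteq> V" "S \<noteq> {}" "critical_graph S {e \<in> E. e \<subseteq> S} (chromatic_number V E)"
proof -
  let ?k = "chromatic_number V E"
  define \<Phi> where "\<Phi> S \<longleftrightarrow> S \<subseteq> V \<and> (\<forall>P. indep_partition E S P \<longrightarrow> ?k \<le> card P)" for S
  have fin: "finite P" if "indep_partition E S P" "S \<subseteq> V" for S P
    using that V(1) finite_subset finite_UnionD unfolding indep_partition_def by metis
  have "\<Phi> V" unfolding \<Phi>_def using fin[of V] chromatic_number_le_card_partition[of _ E V] by blast
  then have "\<exists>S. \<Phi> S \<and> (\<forall>S'. \<Phi> S' \<longrightarrow> card S \<le> card S')" by (rule ex_has_least_nat)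
  then obtain S where S: "\<Phi> S" and min: "\<And>S'. \<Phi> S' \<Longrightarrow> card S \<le> card S'" by blast
  have SV: "S \<subseteq> V" "finite S" using S V finite_subset by (auto simp: \<Phi>_def)
  \<comment> \<open>Edges not contained in \<open>S\<close> cannot lie inside a class.\<close>
  have iff: "indep_partition {e \<in> E. e \<subseteq> S} S P \<longleftrightarrow> indep_partition E S P" for P
  proof -
    have "(\<forall>p\<in>P. \<forall>e\<in>{e \<in> E. e \<subseteq> S}. \<not> e \<subseteq> p) \<longleftrightarrow> (\<forall>p\<in>P. \<forall>e\<in>E. \<not> e \<subseteq> p)" if U: "\<Union>P = S"
    proof (rule ball_cong[OF refl])
      fix p assume "p \<in> P"
      then have "p \<subseteq> S" using U by blast
      then show "(\<forall>e\<in>{e \<in> E. e \<subseteq> S}. \<not> e \<subseteq> p) \<longleftrightarrow> (\<forall>e\<in>E. \<not> e \<subseteq> p)" by auto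
    qed
    then show ?thesis unfolding indep_partition_def by (intro conj_cong refl)
  qed
  have "critical_graph S {e \<in> E. e \<subseteq> S} ?k"
  proof
    show "finite S" by (rule SV)
    show "{e \<in> E. e \<subseteq> S} \<subseteq> [S]\<^bsup>2\<^esup>" using V by (auto simp: nsets_def)
    show "?k \<le> card P" if "indep_partition {e \<in> E. e \<subseteq> S} S P" for P
      using that S iff by (simp add: \<Phi>_def)
    fix y assume y: "y \<in> S"
    have "card (S - {y}) < card S" using y SV by (intro card_Diff1_less)
    then have "\<not> \<Phi> (S - {y})" using min[of "S - {y}"] by linarith
    then obtain P where P: "indep_partition E (S - {y}) P" "card P < ?k"
      using SV by (auto simp: \<Phi>_def not_le)
    have U: "\<Union>P = S - {y}" using P(1) by (simp add: indep_partition_def)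
    have "indep_partition E S (insert {y} P)"
      unfolding indep_partition_def
    proof (intro conjI)
      show "\<Union>(insert {y} P) = S" using U y by auto
      show "\<forall>p\<in>insert {y} P. \<forall>q\<in>insert {y} P. p \<noteq> q \<longrightarrow> p \<inter> q = {}"
        using P(1) U by (auto simp: indep_partition_def)
      show "{} \<notin> insert {y} P" using P(1) by (simp add: indep_partition_def)
      have "\<not> e \<subseteq> {y}" if e: "e \<in> E" for e
      proof -
        obtain a b where "e = {a, b}" "a \<noteq> b" using e V nsets2_cases by blast
        then show ?thesis by auto
      qed
      then show "\<forall>p\<in>insert {y} P. \<forall>e\<in>E. \<not> e \<subseteq> p" using P(1) by (auto simp: indep_partition_def)
    qed
    moreover have "card (insert {y} P) \<le> ?k"
      using P(2) card_insert_le_m1[of ?k P "{y}"] pos by simp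
    moreover have "?k \<le> card (insert {y} P)" using calculation(1) S by (simp add: \<Phi>_def)
    ultimately show "\<exists>P. indep_partition {e \<in> E. e \<subseteq> S} S P \<and> card P = ?k \<and> {y} \<in> P"
      using iff by (intro exI[of _ "insert {y} P"]) auto
  qed
  moreover have "S \<noteq> {}"
  proof
    assume "S = {}"
    then have "indep_partition E S {}" by (simp add: indep_partition_def)
    then show False using S pos by (auto simp: \<Phi>_def)
  qed
  ultimately show thesis using that SV by blast
qed

section \<open>Cliques in realizations\<close>

lemma card_clique_le_degree_seq_clique_number:
  assumes "simple_graph V E" "simple_graph V F" "degree F = degree E" "K \<subseteq> V" "clique K F"
  shows "card K \<le> degree_seq_clique_number (degree_sequence V E)"
proof -
  have fin: "finite V" using assms(1) by (simp add: simple_graph_def)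
  have "card K \<le> clique_number V F"
    unfolding clique_number_def using assms(4,5) fin by (intro Max_ge) auto
  also have "\<dots> \<le> degree_seq_clique_number (degree_sequence V F)"
    by (rule clique_number_le_degree_seq_clique_number[OF assms(2)])
  finally show ?thesis using assms(3) by (simp add: degree_sequence_def)
qed

lemma degree_complete:
  assumes "finite S" "v \<in> S"
  shows "degree ([S]\<^bsup>2\<^esup>) v = card S - 1"
proof -
  have "nbrs ([S]\<^bsup>2\<^esup>) v = S - {v}" using assms by (auto simp: nbrs_def nsets2_iff)
  then show ?thesis using degree_eq_card_nbrs[of "[S]\<^bsup>2\<^esup>" S v] assms by simp
qed

text \<open>Pass to the complement inside \<open>U = S - A\<close>, apply
  \<open>independent_realization\<close> there and complement back: the independent set becomes a
  clique, completely joined to \<open>A\<close>. Edges not inside \<open>U\<close> stay, so the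
  degrees in the whole graph are unchanged.\<close>

lemma clique_realization:
  assumes G: "simple_graph V E" and S: "S \<subseteq> V" and A: "A \<subseteq> S"
    and univ: "\<And>a y. a \<in> A \<Longrightarrow> y \<in> S \<Longrightarrow> y \<noteq> a \<Longrightarrow> {a, y} \<in> E"
    and deg: "\<And>v. v \<in> S \<Longrightarrow> k \<le> degree {e \<in> E. e \<subseteq> S} v + 1"
    and s: "card A + s \<le> k" "card A + 2 * s \<le> card S"
  shows "card A + s \<le> degree_seq_clique_number (degree_sequence V E)"
proof -
  have V: "finite V" "E \<subseteq> [V]\<^bsup>2\<^esup>" using G by (auto simp: simple_graph_def)
  define U where "U = S - A"
  have "finite S" using S V finite_subset by blast
  then have UV: "U \<subseteq> V" "finite U" "finite A" using S A finite_subset by (auto simp: U_def)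
  have cardU: "card U + card A = card S"
    using A S V UV by (simp add: U_def card_Diff_subset card_mono finite_subset)
  let ?N = "[U]\<^bsup>2\<^esup>"
  have NV: "?N \<subseteq> [V]\<^bsup>2\<^esup>" using UV by (intro nsets_mono)
  have finN: "finite ?N" using finite_edges[OF UV(2) subset_refl] .
  have finE: "finite E" using finite_edges[OF V] .
  have compl: "degree (?N - H) v + degree (?N \<inter> H) v = degree ?N v" for H v
    using degree_Un_disjoint[of "?N - H" "?N \<inter> H" v] finN by (simp add: Un_Diff_Int Diff_Int_distrib2)
  \<comment> \<open>By \<open>deg\<close>, \<open>v\<close> has at least
    \<open>k - 1 - card A\<close> neighbours in \<open>U\<close>, so its degree in the complement is
    at most \<open>card U - (k - card A)\<close>.\<close>
  have "degree (?N - E) v + s \<le> card U" if v: "v \<in> U" for v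
  proof -
    have "nbrs {e \<in> E. e \<subseteq> S} v \<subseteq> nbrs (?N \<inter> E) v \<union> A"
    proof
      fix w assume w: "w \<in> nbrs {e \<in> E. e \<subseteq> S} v"
      then have e: "{v, w} \<in> E" "w \<in> S" by (auto simp: nbrs_def)
      moreover have "v \<noteq> w" using edgesD(3)[OF V(2) e(1)] .
      ultimately show "w \<in> nbrs (?N \<inter> E) v \<union> A" using v by (auto simp: nbrs_def nsets2_iff U_def)
    qed
    then have "card (nbrs {e \<in> E. e \<subseteq> S} v) \<le> card (nbrs (?N \<inter> E) v \<union> A)"
      using UV finite_nbrs[OF UV(2), of "?N \<inter> E" v] by (intro card_mono) auto
    also have "\<dots> \<le> card (nbrs (?N \<inter> E) v) + card A" by (rule card_Un_le)
    finally have "card (nbrs {e \<in> E. e \<subseteq> S} v) \<le> card (nbrs (?N \<inter> E) v) + card A" .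
    moreover have "{e \<in> E. e \<subseteq> S} \<subseteq> [V]\<^bsup>2\<^esup>" using V by blast
    ultimately have "degree {e \<in> E. e \<subseteq> S} v \<le> degree (?N \<inter> E) v + card A"
      using degree_eq_card_nbrs[of "{e \<in> E. e \<subseteq> S}" V v] degree_eq_card_nbrs[of "?N \<inter> E" U v] by simp
    moreover have "degree (?N - E) v + degree (?N \<inter> E) v = card U - 1"
      using compl[of E v] degree_complete[OF UV(2) v] by simp
    moreover have "card U > 0" using v UV card_gt_0_iff by blast
    ultimately show ?thesis using deg[of v] v s by (auto simp: U_def)
  qed
  then have "\<exists>F I. F \<subseteq> ?N \<and> degree F = degree (?N - E) \<and> I \<subseteq> U \<and> card I = s \<and> (\<forall>e\<in>F. \<not> e \<subseteq> I)"
    using UV s cardU by (intro independent_realization) auto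
  then obtain F I where F: "F \<subseteq> ?N" "degree F = degree (?N - E)"
    and I: "I \<subseteq> U" "card I = s" "\<forall>e\<in>F. \<not> e \<subseteq> I"
    by (elim exE conjE)
  define E' where "E' = (E - ?N) \<union> (?N - F)"
  have "degree E' v = degree E v" for v
  proof -
    have "degree E' v = degree (E - ?N) v + degree (?N - F) v"
      unfolding E'_def using finE finN by (intro degree_Un_disjoint) auto
    moreover have "degree (?N - F) v = degree (?N \<inter> E) v"
      using compl[of F v] compl[of E v] F by (simp add: Int_absorb1)
    moreover have "degree E v = degree (E - ?N) v + degree (?N \<inter> E) v"
      using degree_Un_disjoint[of "E - ?N" "?N \<inter> E" v] finE
      by (simp add: Int_commute Un_Diff_Int Diff_Int_distrib2)
    ultimately show ?thesis by simp
  qed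
  then have degE': "degree E' = degree E" by blast
  have G': "simple_graph V E'" using V NV by (auto simp: simple_graph_def E'_def)
  have IS: "I \<subseteq> S" using I by (auto simp: U_def)
  have "clique (A \<union> I) E'"
    unfolding clique_def
  proof (intro ballI impI)
    \<comment> \<open>Edges at \<open>A\<close> are not inside \<open>U\<close> and survive the
      replacement.\<close>
    have out: "{a, y} \<in> E'" if "a \<in> A" "y \<in> S" "y \<noteq> a" for a y
      using univ[OF that] that by (auto simp: E'_def nsets2_iff U_def)
    fix x y assume xy: "x \<in> A \<union> I" "y \<in> A \<union> I" "x \<noteq> y"
    consider "x \<in> A" | "y \<in> A" | "x \<in> I" "y \<in> I" using xy by blast
    then show "{x, y} \<in> E'"
    proof cases
      case 1
      then show ?thesis using out[of x y] xy A IS by auto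
    next
      case 2
      then show ?thesis using out[of y x] xy A IS by (auto simp: insert_commute)
    next
      case 3
      then have "{x, y} \<in> ?N" "{x, y} \<notin> F" using I xy nsets2_iff[of x y U] by auto
      then show ?thesis by (simp add: E'_def)
    qed
  qed
  moreover have "A \<union> I \<subseteq> V" using A IS S by blast
  ultimately have "card (A \<union> I) \<le> degree_seq_clique_number (degree_sequence V E)"
    using card_clique_le_degree_seq_clique_number[OF G G' degE'] by blast
  moreover have "finite I" "A \<inter> I = {}" using I finite_subset[OF I(1) UV(2)] by (auto simp: U_def)
  then have "card (A \<union> I) = card A + s" using UV I by (simp add: card_Un_disjoint)
  ultimately show ?thesis by simp
qed

theorem theorem3p4:
  fixes V :: "'a set" and E :: "'a set set"
  assumes "simple_graph V E"
  shows "real (chromatic_number V E)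
           \<le> 4 / 5 * real (degree_seq_clique_number (degree_sequence V E))
              + 1 / 5 * real (max_degree V E) + 1"
proof (cases "chromatic_number V E = 0")
  case False
  have V: "finite V" "E \<subseteq> [V]\<^bsup>2\<^esup>" using assms by (auto simp: simple_graph_def)
  define k where "k = chromatic_number V E"
  define \<omega> where "\<omega> = degree_seq_clique_number (degree_sequence V E)"
  obtain S where S: "S \<subseteq> V" "S \<noteq> {}" and crit: "critical_graph S {e \<in> E. e \<subseteq> S} k"
    using obtain_critical_graph[OF V] False by (auto simp: k_def)
  interpret critical_graph S "{e \<in> E. e \<subseteq> S}" k by (rule crit)
  obtain A where A: "A \<subseteq> S" "card A \<le> k"
    and univ: "\<And>a y. a \<in> A \<Longrightarrow> y \<in> S \<Longrightarrow> y \<noteq> a \<Longrightarrow> {a, y} \<in> {e \<in> E. e \<subseteq> S}"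
    and bound: "2 * k \<le> card S + card A \<or>
      (\<exists>v\<in>S. 5 * k \<le> 2 * card S + 2 * card A + degree {e \<in> E. e \<subseteq> S} v + 3)"
    using universal_or_large_degree[OF S(2)] by blast
  have cardA: "card A \<le> card S" using A fin by (intro card_mono)
  have clique: "card A + s \<le> \<omega>" if "card A + s \<le> k" "card A + 2 * s \<le> card S" for s
    unfolding \<omega>_def using clique_realization[OF assms S(1) A(1) _ degree_ge that] univ by blast
  have \<Delta>: "degree {e \<in> E. e \<subseteq> S} v \<le> max_degree V E" if "v \<in> S" for v
  proof -
    have "degree {e \<in> E. e \<subseteq> S} v \<le> degree E v" by (rule degree_mono[OF finite_edges[OF V]]) auto
    also have "\<dots> \<le> max_degree V E"
      unfolding max_degree_def using V S that by (intro Max_ge) auto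
    finally show ?thesis .
  qed
  have "5 * k \<le> 4 * \<omega> + max_degree V E + 5"
  proof (cases "2 * k \<le> card S + card A")
    case True
    obtain v where v: "v \<in> S" using S by blast
    \<comment> \<open>For \<open>s = k - card A\<close> the size condition of \<open>clique\<close>
      is exactly the case assumption.\<close>
    have "k \<le> \<omega>" using clique[of "k - card A"] True A(2) by simp
    moreover have "k \<le> max_degree V E + 1" using degree_ge[OF v] \<Delta>[OF v] by simp
    ultimately show ?thesis by simp
  next
    case False
    then obtain v where v: "v \<in> S" "5 * k \<le> 2 * card S + 2 * card A + degree {e \<in> E. e \<subseteq> S} v + 3"
      using bound by blast
    \<comment> \<open>Here \<open>2 * k\<close> exceeds \<open>card S + card A\<close>, which keeps
      this clique size below \<open>k\<close>.\<close>
    have "card A + (card S - card A) div 2 \<le> \<omega>"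
      using clique[of "(card S - card A) div 2"] False cardA by simp
    \<comment> \<open>Rounding down costs at most one half, hence 2 after multiplication by 4; with
      the constant 3 of the degree bound this makes the 5 in the goal.\<close>
    then have "2 * card S + 2 * card A \<le> 4 * \<omega> + 2" using cardA by linarith
    then show ?thesis using v \<Delta>[OF v(1)] by linarith
  qed
  then have "5 * real k \<le> 4 * real \<omega> + real (max_degree V E) + 5" by linarith
  then show ?thesis by (simp add: k_def \<omega>_def)
qed simp

end
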